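(* Let $\phi:G\to H$ be a homomorphism between two Riemannian Lie groups with differential $\xi:\mathfrak g\to\mathfrak h$ at the identity. Suppose that $\phi$ is a Riemannian immersion, $[\mathfrak g,\mathfrak g]=\mathfrak g$, any derivation of $\mathfrak g$ is inner, and $\xi(\mathfrak g)$ is an ideal of $\mathfrak h$. Then $\phi$ is harmonic.
   Context: All Lie groups are real and connected. A Riemannian Lie group is a Lie group with a left invariant Riemannian metric; $\mathfrak g,\mathfrak h$ are the Lie algebras of $G,H$. A Riemannian immersion is an isometric immersion. A smooth map $\phi:(M,g)\to(N,h)$ of Riemannian manifolds is harmonic if its tension field $\tau(\phi)=\mathrm{tr}_g\nabla d\phi$ vanishes. *)

theory Defs
  imports "HOL-Analysis.Analysis" "HOL-Library.Function_Algebras"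
begin

section \<open>Pointwise real vector space structure on functions\<close>

instantiation "fun" :: (type, real_vector) real_vector
begin

definition scaleR_fun :: "real \<Rightarrow> ('a \<Rightarrow> 'b) \<Rightarrow> 'a \<Rightarrow> 'b"
  where "scaleR_fun r f = (\<lambda>x. r *\<^sub>R f x)"

instance
  by standard (auto simp: scaleR_fun_def fun_eq_iff algebra_simps)

end


section \<open>Smooth manifolds\<close>

text \<open>Only used on open sets of finite-dimensional spaces, where differentiability together with
  directional derivatives of class \<open>C\<^sup>k\<close> amounts to class \<open>C\<^sup>k\<^sup>+\<^sup>1\<close>.\<close>

primrec Ck_on :: "nat \<Rightarrow> 'a::real_normed_vector set \<Rightarrow> ('a \<Rightarrow> 'b::real_normed_vector) \<Rightarrow> bool"
where
  "Ck_on 0 S f \<longleftrightarrow> continuous_on S f"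
| "Ck_on (Suc k) S f \<longleftrightarrow> (\<forall>x\<in>S. f differentiable (at x)) \<and>
     (\<forall>v. Ck_on k S (\<lambda>x. frechet_derivative f (at x) v))"

definition smooth_on :: "'a::real_normed_vector set \<Rightarrow> ('a \<Rightarrow> 'b::real_normed_vector) \<Rightarrow> bool"
  where "smooth_on S f \<longleftrightarrow> (\<forall>k. Ck_on k S f)"

text \<open>A chart is a pair of its domain and its coordinate map; the values of the coordinate map
  outside the domain are irrelevant.\<close>

type_synonym ('m, 'e) chart = "'m set \<times> ('m \<Rightarrow> 'e)"

definition chart_inv :: "('m, 'e) chart \<Rightarrow> 'e \<Rightarrow> 'm"
  where "chart_inv c = inv_into (fst c) (snd c)"

definition is_chart :: "('m::topological_space, 'e::real_normed_vector) chart \<Rightarrow> bool"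
  where "is_chart c \<longleftrightarrow> open (fst c) \<and> open (snd c ` fst c) \<and>
    homeomorphism (fst c) (snd c ` fst c) (snd c) (chart_inv c)"

definition coord_map :: "('m, 'e) chart \<Rightarrow> ('n, 'f) chart \<Rightarrow> ('m \<Rightarrow> 'n) \<Rightarrow> 'e \<Rightarrow> 'f"
  where "coord_map c d f = snd d \<circ> f \<circ> chart_inv c"

text \<open>The model space is a finite-dimensional \<^class>\<open>real_inner\<close> space rather than a
  \<^class>\<open>euclidean_space\<close>, since the latter has positive dimension and would exclude
  zero-dimensional manifolds.  The atlas need not be maximal.\<close>

locale smooth_manifold =
  fixes A :: "('m::{t2_space, second_countable_topology}, 'e::real_inner) chart set"
  assumes finite_dim: "\<exists>B::'e set. finite B \<and> span B = UNIV"
    and charts: "c \<in> A \<Longrightarrow> is_chart c"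
    and cover: "(\<Union>c\<in>A. fst c) = UNIV"
    and compatible: "\<lbrakk>c \<in> A; d \<in> A\<rbrakk> \<Longrightarrow>
      smooth_on (snd c ` (fst c \<inter> fst d)) (coord_map c d (\<lambda>p. p))"

definition charts_at :: "('m, 'e) chart set \<Rightarrow> 'm \<Rightarrow> ('m, 'e) chart set"
  where "charts_at A p = {c \<in> A. p \<in> fst c}"

definition chart_at :: "('m, 'e) chart set \<Rightarrow> 'm \<Rightarrow> ('m, 'e) chart"
  where "chart_at A p = (SOME c. c \<in> charts_at A p)"

definition smooth_map ::
  "('m::topological_space, 'e::real_normed_vector) chart set \<Rightarrow>
   ('n::topological_space, 'f::real_normed_vector) chart set \<Rightarrow> ('m \<Rightarrow> 'n) \<Rightarrow> bool"
  where "smooth_map A B f \<longleftrightarrow> continuous_on UNIV f \<and>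
    (\<forall>c\<in>A. \<forall>d\<in>B. smooth_on (snd c ` (fst c \<inter> f -` fst d)) (coord_map c d f))"

definition prod_atlas ::
  "('m, 'e) chart set \<Rightarrow> ('n, 'f) chart set \<Rightarrow> ('m \<times> 'n, 'e \<times> 'f) chart set"
  where "prod_atlas A B = {(fst c \<times> fst d, map_prod (snd c) (snd d)) | c d. c \<in> A \<and> d \<in> B}"


section \<open>Tangent vectors and vector fields\<close>

text \<open>A tangent vector at \<open>p\<close> is the family of its components in all charts around \<open>p\<close>,
  related by the derivatives of the transition maps.  Components at charts not around \<open>p\<close> are set
  to 0, so that equality of tangent vectors is equality of functions.\<close>

type_synonym ('m, 'e) tangent = "('m, 'e) chart \<Rightarrow> 'e"

definition tangent_space ::
  "('m, 'e::real_normed_vector) chart set \<Rightarrow> 'm \<Rightarrow> ('m, 'e) tangent set"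
  where "tangent_space A p = {v.
    (\<forall>c\<in>charts_at A p. \<forall>d\<in>charts_at A p.
       v d = frechet_derivative (coord_map c d (\<lambda>q. q)) (at (snd c p)) (v c)) \<and>
    (\<forall>c. c \<notin> charts_at A p \<longrightarrow> v c = 0)}"

text \<open>The tangent vector at \<open>p\<close> whose component in the chart \<open>c\<close> is \<open>u\<close>.\<close>

definition coord_vector ::
  "('m, 'e::real_normed_vector) chart set \<Rightarrow> ('m, 'e) chart \<Rightarrow> 'm \<Rightarrow> 'e \<Rightarrow> ('m, 'e) tangent"
  where "coord_vector A c p u = (\<lambda>d. if d \<in> charts_at A p
     then frechet_derivative (coord_map c d (\<lambda>q. q)) (at (snd c p)) u else 0)"

definition differential ::
  "('m, 'e::real_normed_vector) chart set \<Rightarrow> ('n, 'f::real_normed_vector) chart set \<Rightarrow>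
   ('m \<Rightarrow> 'n) \<Rightarrow> 'm \<Rightarrow> ('m, 'e) tangent \<Rightarrow> ('n, 'f) tangent"
  where "differential A B f p v = (\<lambda>d. if d \<in> charts_at B (f p)
     then let c = chart_at A p in frechet_derivative (coord_map c d f) (at (snd c p)) (v c)
     else 0)"

definition field_rep :: "('m, 'e) chart \<Rightarrow> ('m \<Rightarrow> ('m, 'e) tangent) \<Rightarrow> 'e \<Rightarrow> 'e"
  where "field_rep c X = (\<lambda>x. X (chart_inv c x) c)"

definition field_bracket ::
  "('m, 'e::real_normed_vector) chart set \<Rightarrow> ('m \<Rightarrow> ('m, 'e) tangent) \<Rightarrow>
   ('m \<Rightarrow> ('m, 'e) tangent) \<Rightarrow> 'm \<Rightarrow> ('m, 'e) tangent"
  where "field_bracket A X Y p = (\<lambda>c. if c \<in> charts_at A p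
     then frechet_derivative (field_rep c Y) (at (snd c p)) (X p c)
        - frechet_derivative (field_rep c X) (at (snd c p)) (Y p c)
     else 0)"


section \<open>Riemannian metrics, the Levi-Civita connection and harmonic maps\<close>

definition local_metric ::
  "('m, 'e::real_normed_vector) chart set \<Rightarrow>
   ('m \<Rightarrow> ('m, 'e) tangent \<Rightarrow> ('m, 'e) tangent \<Rightarrow> real) \<Rightarrow> ('m, 'e) chart \<Rightarrow> 'e \<Rightarrow> 'e \<Rightarrow> 'e \<Rightarrow> real"
  where "local_metric A g c x u v =
    (let p = chart_inv c x in g p (coord_vector A c p u) (coord_vector A c p v))"

locale riemannian_manifold = smooth_manifold A
  for A :: "('m::{t2_space, second_countable_topology}, 'e::real_inner) chart set" +
  fixes g :: "'m \<Rightarrow> ('m, 'e) tangent \<Rightarrow> ('m, 'e) tangent \<Rightarrow> real"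
  assumes metric_add: "\<lbrakk>u \<in> tangent_space A p; v \<in> tangent_space A p; w \<in> tangent_space A p\<rbrakk>
      \<Longrightarrow> g p (u + v) w = g p u w + g p v w"
    and metric_scale: "\<lbrakk>u \<in> tangent_space A p; w \<in> tangent_space A p\<rbrakk>
      \<Longrightarrow> g p (r *\<^sub>R u) w = r * g p u w"
    and metric_sym: "\<lbrakk>u \<in> tangent_space A p; v \<in> tangent_space A p\<rbrakk> \<Longrightarrow> g p u v = g p v u"
    and metric_pos: "\<lbrakk>u \<in> tangent_space A p; u \<noteq> 0\<rbrakk> \<Longrightarrow> g p u u > 0"
    and metric_smooth: "\<And>u v. c \<in> A \<Longrightarrow>
      smooth_on (snd c ` fst c) (\<lambda>x. local_metric A g c x u v)"

text \<open>The Christoffel symbols of a field \<open>G\<close> of inner products, as a bilinear map: with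
  \<open>\<Gamma> x u v = \<Sum>\<^sub>k (\<Sum>\<^sub>i\<^sub>j \<Gamma>\<^sup>k\<^sub>i\<^sub>j u\<^sub>i v\<^sub>j) e\<^sub>k\<close>, the defining equation is
  \<open>2 \<Sum>\<^sub>k G\<^sub>k\<^sub>l \<Gamma>\<^sup>k\<^sub>i\<^sub>j = \<partial>\<^sub>i G\<^sub>j\<^sub>l + \<partial>\<^sub>j G\<^sub>i\<^sub>l - \<partial>\<^sub>l G\<^sub>i\<^sub>j\<close>.\<close>

definition christoffel :: "('e \<Rightarrow> 'e \<Rightarrow> 'e \<Rightarrow> real) \<Rightarrow> 'e \<Rightarrow> 'e \<Rightarrow> 'e \<Rightarrow> 'e::real_normed_vector"
  where "christoffel G x u v = (THE w. \<forall>z. 2 * G x w z =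
      frechet_derivative (\<lambda>y. G y v z) (at x) u
    + frechet_derivative (\<lambda>y. G y u z) (at x) v
    - frechet_derivative (\<lambda>y. G y u v) (at x) z)"

text \<open>In coordinates: the covariant derivative in direction \<open>u\<close> at \<open>x\<close> of a vector field \<open>V\<close>
  along a map \<open>f\<close>, for the pullback by \<open>f\<close> of the Levi-Civita connection of \<open>G\<close>.  For the
  identity map this is the Levi-Civita connection itself.\<close>

definition cov_deriv_along ::
  "('f \<Rightarrow> 'f \<Rightarrow> 'f \<Rightarrow> real) \<Rightarrow> ('e::real_normed_vector \<Rightarrow> 'f::real_normed_vector) \<Rightarrow>
   ('e \<Rightarrow> 'f) \<Rightarrow> 'e \<Rightarrow> 'e \<Rightarrow> 'f"
  where "cov_deriv_along G f V x u =
    frechet_derivative V (at x) u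
    + christoffel G (f x) (frechet_derivative f (at x) u) (V x)"

text \<open>\<open>(\<nabla>df)(v, w) = \<nabla>\<^sub>v (df(W)) - df(\<nabla>\<^sub>v W)\<close> for any extension \<open>W\<close> of \<open>w\<close>; here \<open>W\<close> is the
  extension with constant components in the chosen chart.\<close>

definition second_fundamental_form ::
  "('m, 'e::real_normed_vector) chart set \<Rightarrow>
   ('m \<Rightarrow> ('m, 'e) tangent \<Rightarrow> ('m, 'e) tangent \<Rightarrow> real) \<Rightarrow>
   ('n, 'f::real_normed_vector) chart set \<Rightarrow>
   ('n \<Rightarrow> ('n, 'f) tangent \<Rightarrow> ('n, 'f) tangent \<Rightarrow> real) \<Rightarrow>
   ('m \<Rightarrow> 'n) \<Rightarrow> 'm \<Rightarrow> ('m, 'e) tangent \<Rightarrow> ('m, 'e) tangent \<Rightarrow> ('n, 'f) tangent"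
  where "second_fundamental_form A g B h f p v w = (\<lambda>d. if d \<in> charts_at B (f p)
     then let c = chart_at A p; x = snd c p; F = coord_map c d f; W = (\<lambda>y. w c)
       in cov_deriv_along (local_metric B h d) F (\<lambda>y. frechet_derivative F (at y) (W y)) x (v c)
        - frechet_derivative F (at x)
            (cov_deriv_along (local_metric A g c) (\<lambda>y. y) W x (v c))
     else 0)"

definition orthonormal_basis ::
  "('m, 'e::real_normed_vector) chart set \<Rightarrow>
   ('m \<Rightarrow> ('m, 'e) tangent \<Rightarrow> ('m, 'e) tangent \<Rightarrow> real) \<Rightarrow> 'm \<Rightarrow> ('m, 'e) tangent set \<Rightarrow> bool"
  where "orthonormal_basis A g p E \<longleftrightarrow> finite E \<and> E \<subseteq> tangent_space A p \<and>
    (\<forall>u\<in>E. \<forall>v\<in>E. g p u v = (if u = v then 1 else 0)) \<and> span E = tangent_space A p"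

definition tension_field ::
  "('m, 'e::real_normed_vector) chart set \<Rightarrow>
   ('m \<Rightarrow> ('m, 'e) tangent \<Rightarrow> ('m, 'e) tangent \<Rightarrow> real) \<Rightarrow>
   ('n, 'f::real_normed_vector) chart set \<Rightarrow>
   ('n \<Rightarrow> ('n, 'f) tangent \<Rightarrow> ('n, 'f) tangent \<Rightarrow> real) \<Rightarrow>
   ('m \<Rightarrow> 'n) \<Rightarrow> 'm \<Rightarrow> ('n, 'f) tangent"
  where "tension_field A g B h f p =
    (\<Sum>u\<in>(SOME E. orthonormal_basis A g p E). second_fundamental_form A g B h f p u u)"

definition harmonic ::
  "('m::topological_space, 'e::real_normed_vector) chart set \<Rightarrow>
   ('m \<Rightarrow> ('m, 'e) tangent \<Rightarrow> ('m, 'e) tangent \<Rightarrow> real) \<Rightarrow>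
   ('n::topological_space, 'f::real_normed_vector) chart set \<Rightarrow>
   ('n \<Rightarrow> ('n, 'f) tangent \<Rightarrow> ('n, 'f) tangent \<Rightarrow> real) \<Rightarrow> ('m \<Rightarrow> 'n) \<Rightarrow> bool"
  where "harmonic A g B h f \<longleftrightarrow> smooth_map A B f \<and> (\<forall>p. tension_field A g B h f p = 0)"

definition riemannian_immersion ::
  "('m::topological_space, 'e::real_normed_vector) chart set \<Rightarrow>
   ('m \<Rightarrow> ('m, 'e) tangent \<Rightarrow> ('m, 'e) tangent \<Rightarrow> real) \<Rightarrow>
   ('n::topological_space, 'f::real_normed_vector) chart set \<Rightarrow>
   ('n \<Rightarrow> ('n, 'f) tangent \<Rightarrow> ('n, 'f) tangent \<Rightarrow> real) \<Rightarrow> ('m \<Rightarrow> 'n) \<Rightarrow> bool"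
  where "riemannian_immersion A g B h f \<longleftrightarrow> smooth_map A B f \<and>
    (\<forall>p. inj_on (differential A B f p) (tangent_space A p) \<and>
      (\<forall>u\<in>tangent_space A p. \<forall>v\<in>tangent_space A p.
         h (f p) (differential A B f p u) (differential A B f p v) = g p u v))"


section \<open>Lie groups and their Lie algebras\<close>

text \<open>Lie groups are connected throughout.\<close>

locale lie_group = group mul one inverse + smooth_manifold A
  for mul :: "'g::{t2_space, second_countable_topology} \<Rightarrow> 'g \<Rightarrow> 'g"
    and one :: 'g and inverse :: "'g \<Rightarrow> 'g" and A :: "('g, 'e::real_inner) chart set" +
  assumes smooth_mult: "smooth_map (prod_atlas A A) A (\<lambda>(a, b). mul a b)"
    and smooth_inverse: "smooth_map A A inverse"
    and connected: "connected (UNIV :: 'g set)"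

locale riemannian_lie_group = lie_group mul one inverse A + riemannian_manifold A g
  for mul :: "'g::{t2_space, second_countable_topology} \<Rightarrow> 'g \<Rightarrow> 'g"
    and one :: 'g and inverse :: "'g \<Rightarrow> 'g" and A :: "('g, 'e::real_inner) chart set"
    and g :: "'g \<Rightarrow> ('g, 'e) tangent \<Rightarrow> ('g, 'e) tangent \<Rightarrow> real" +
  assumes left_invariant: "\<lbrakk>u \<in> tangent_space A p; v \<in> tangent_space A p\<rbrakk> \<Longrightarrow>
    g (mul a p) (differential A A (mul a) p u) (differential A A (mul a) p v) = g p u v"

definition lie_group_hom ::
  "('g \<Rightarrow> 'g \<Rightarrow> 'g) \<Rightarrow> ('g::topological_space, 'e::real_normed_vector) chart set \<Rightarrow>
   ('k \<Rightarrow> 'k \<Rightarrow> 'k) \<Rightarrow> ('k::topological_space, 'f::real_normed_vector) chart set \<Rightarrow>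
   ('g \<Rightarrow> 'k) \<Rightarrow> bool"
  where "lie_group_hom mG A mH B f \<longleftrightarrow>
    smooth_map A B f \<and> (\<forall>a b. f (mG a b) = mH (f a) (f b))"

definition left_invariant_field ::
  "('g \<Rightarrow> 'g \<Rightarrow> 'g) \<Rightarrow> 'g \<Rightarrow> ('g, 'e::real_normed_vector) chart set \<Rightarrow>
   ('g, 'e) tangent \<Rightarrow> 'g \<Rightarrow> ('g, 'e) tangent"
  where "left_invariant_field mul one A v = (\<lambda>a. differential A A (mul a) one v)"

text \<open>The Lie algebra is the tangent space at the identity, with the bracket of left invariant
  vector fields.\<close>

definition lie_algebra ::
  "'g \<Rightarrow> ('g, 'e::real_normed_vector) chart set \<Rightarrow> ('g, 'e) tangent set"
  where "lie_algebra one A = tangent_space A one"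

definition lie_bracket ::
  "('g \<Rightarrow> 'g \<Rightarrow> 'g) \<Rightarrow> 'g \<Rightarrow> ('g, 'e::real_normed_vector) chart set \<Rightarrow>
   ('g, 'e) tangent \<Rightarrow> ('g, 'e) tangent \<Rightarrow> ('g, 'e) tangent"
  where "lie_bracket mul one A u v = field_bracket A
    (left_invariant_field mul one A u) (left_invariant_field mul one A v) one"

text \<open>Below, a Lie algebra is given by its carrier \<open>L\<close> and bracket \<open>br\<close>.\<close>

definition derived_algebra :: "'v::real_vector set \<Rightarrow> ('v \<Rightarrow> 'v \<Rightarrow> 'v) \<Rightarrow> 'v set"
  where "derived_algebra L br = span {br x y | x y. x \<in> L \<and> y \<in> L}"

definition lie_derivation :: "'v::real_vector set \<Rightarrow> ('v \<Rightarrow> 'v \<Rightarrow> 'v) \<Rightarrow> ('v \<Rightarrow> 'v) \<Rightarrow> bool"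
  where "lie_derivation L br D \<longleftrightarrow> (\<forall>x\<in>L. D x \<in> L) \<and>
    (\<forall>x\<in>L. \<forall>y\<in>L. D (x + y) = D x + D y) \<and> (\<forall>r. \<forall>x\<in>L. D (r *\<^sub>R x) = r *\<^sub>R D x) \<and>
    (\<forall>x\<in>L. \<forall>y\<in>L. D (br x y) = br (D x) y + br x (D y))"

definition inner_derivation :: "'v set \<Rightarrow> ('v \<Rightarrow> 'v \<Rightarrow> 'v) \<Rightarrow> ('v \<Rightarrow> 'v) \<Rightarrow> bool"
  where "inner_derivation L br D \<longleftrightarrow> (\<exists>a\<in>L. \<forall>x\<in>L. D x = br a x)"

definition lie_ideal :: "'v::real_vector set \<Rightarrow> ('v \<Rightarrow> 'v \<Rightarrow> 'v) \<Rightarrow> 'v set \<Rightarrow> bool"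
  where "lie_ideal L br I \<longleftrightarrow> subspace I \<and> I \<subseteq> L \<and> (\<forall>x\<in>L. \<forall>y\<in>I. br x y \<in> I)"

end

theory Submission
  imports Defs
begin

text \<open>For a left invariant metric, a left invariant field \<open>X\<close> satisfies
  \<open>\<langle>\<nabla>\<^sub>X X, Z\<rangle> = \<langle>[Z, X], X\<rangle>\<close> for all left invariant \<open>Z\<close>.  Left invariant fields on \<open>G\<close> are
  \<open>\<phi>\<close>-related to left invariant fields on \<open>H\<close>, so in a left invariant orthonormal frame \<open>e\<^sub>i\<close> the
  tension field of \<open>\<phi>\<close> is \<open>\<Sum>\<^sub>i \<nabla>\<^bsub>\<xi> e\<^sub>i\<^esub> \<xi> e\<^sub>i - d\<phi> (\<Sum>\<^sub>i \<nabla>\<^bsub>e\<^sub>i\<^esub> e\<^sub>i)\<close>.  Paired with \<open>Z\<close>, these sums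
  become traces of \<open>ad Z\<close>, on the ideal \<open>\<xi>(\<gg>)\<close> of \<open>\<hh>\<close> and on \<open>\<gg>\<close> respectively.  Both maps
  correspond to derivations of \<open>\<gg>\<close>, which are inner, and \<open>ad a\<close> is traceless for
  \<open>a \<in> \<gg> = [\<gg>, \<gg>]\<close>, being a sum of commutators.\<close>

section \<open>Differential calculus\<close>

text \<open>The metric identity is the Koszul formula: inner products of left invariant fields are
  constant, so the terms that differentiate an inner product drop out and only brackets remain. The
  ideal hypothesis is what turns the trace over the image of \<open>\<xi>\<close> into the trace of
  an endomorphism of the source algebra: brackets with \<open>\<xi> x\<close> stay in the image,
  injectivity pulls them back, and the isometry keeps the inner products. The two sums vanish
  separately, so tangential and normal parts are never split.

  Two features of the definitions shape the rest. The tension field sums over an orthonormal basis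
  chosen at each point separately, so that basis has to be carried back to the identity. And
  brackets, connection and second fundamental form are given by components in charts, so the second
  derivative of the coordinate form of \<open>\<phi>\<close> appears; it is handled only through
  relatedness of fields and the symmetry of second derivatives, which also yields the Jacobi
  identity.\<close>

abbreviation fderiv :: "('a::real_normed_vector \<Rightarrow> 'b::real_normed_vector) \<Rightarrow> 'a \<Rightarrow> 'a \<Rightarrow> 'b"
  where "fderiv f x \<equiv> frechet_derivative f (at x)"

lemma fderiv_eqI: "(f has_derivative f') (at x) \<Longrightarrow> fderiv f x = f'"
  using frechet_derivative_at by metis

lemma fderiv_cong_open:
  assumes "open S" "x \<in> S" "\<And>y. y \<in> S \<Longrightarrow> f y = g y"
  shows "fderiv f x = fderiv g x"
proof -
  \<comment> \<open>\<open>frechet_derivative\<close> chooses among all derivatives, so equivalent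
    predicates give equal choices even where no derivative exists.\<close>
  have "(f has_derivative f') (at x) \<longleftrightarrow> (g has_derivative f') (at x)" for f'
    using has_derivative_transform_within_open[OF _ assms(1,2), of f f' UNIV g]
      has_derivative_transform_within_open[OF _ assms(1,2), of g f' UNIV f] assms(3) by auto
  then show ?thesis unfolding frechet_derivative_def by simp
qed

lemma differentiable_cong_open:
  assumes "open S" "x \<in> S" "\<And>y. y \<in> S \<Longrightarrow> f y = g y" "f differentiable (at x)"
  shows "g differentiable (at x)"
  using assms has_derivative_transform_within_open[OF _ assms(1,2), of f _ UNIV g]
  unfolding differentiable_def by blast

lemma Ck_on_cong:
  assumes "open S" "\<And>x. x \<in> S \<Longrightarrow> f x = g x" "Ck_on k S f"
  shows "Ck_on k S g"
  using assms(2,3)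
proof (induction k arbitrary: f g)
  case 0
  then show ?case by (simp cong: continuous_on_cong_simp)
next
  case (Suc k)
  have "g differentiable (at x)" if "x \<in> S" for x
    using differentiable_cong_open[OF assms(1) that, of f g] Suc.prems that by auto
  moreover have "Ck_on k S (\<lambda>x. fderiv g x v)" for v
  proof (rule Suc.IH)
    show "Ck_on k S (\<lambda>x. fderiv f x v)" using Suc.prems by simp
    show "\<And>x. x \<in> S \<Longrightarrow> fderiv f x v = fderiv g x v"
      using fderiv_cong_open[OF assms(1)] Suc.prems(1) by metis
  qed
  ultimately show ?case by simp
qed

lemma Ck_on_subset: "Ck_on k S f \<Longrightarrow> T \<subseteq> S \<Longrightarrow> Ck_on k T f"
  by (induction k arbitrary: f) (auto intro: continuous_on_subset)

lemma smooth_on_subset: "smooth_on S f \<Longrightarrow> T \<subseteq> S \<Longrightarrow> smooth_on T f"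
  unfolding smooth_on_def using Ck_on_subset by blast

lemma smooth_on_cong:
  "open S \<Longrightarrow> (\<And>x. x \<in> S \<Longrightarrow> f x = g x) \<Longrightarrow> smooth_on S f \<Longrightarrow> smooth_on S g"
  unfolding smooth_on_def using Ck_on_cong by blast

lemma smooth_on_differentiable: "smooth_on S f \<Longrightarrow> x \<in> S \<Longrightarrow> f differentiable (at x)"
  unfolding smooth_on_def by (metis Ck_on.simps(2))

lemma smooth_on_fderiv: "smooth_on S f \<Longrightarrow> smooth_on S (\<lambda>x. fderiv f x v)"
  unfolding smooth_on_def by (metis Ck_on.simps(2))

lemma smooth_on_has_derivative:
  "smooth_on S f \<Longrightarrow> x \<in> S \<Longrightarrow> (f has_derivative fderiv f x) (at x)"
  using smooth_on_differentiable frechet_derivative_works by blast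

lemma linear_fderiv: "f differentiable (at x) \<Longrightarrow> linear (fderiv f x)"
  using frechet_derivative_works has_derivative_linear by blast

lemma linear_smooth_fderiv: "smooth_on S f \<Longrightarrow> x \<in> S \<Longrightarrow> linear (fderiv f x)"
  using linear_fderiv smooth_on_differentiable by blast

lemma smooth_on_continuous_on: "smooth_on S f \<Longrightarrow> continuous_on S f"
  unfolding smooth_on_def by (metis Ck_on.simps(1))

section \<open>Slices of smooth maps on a product\<close>

lemma has_derivative_Pair_left:
  assumes "(f has_derivative f') (at (x, y))"
  shows "((\<lambda>x. f (x, y)) has_derivative (\<lambda>v. f' (v, 0))) (at x)"
  using diff_chain_at[OF has_derivative_Pair[OF has_derivative_ident has_derivative_const] assms]
  by (simp add: o_def)

lemma has_derivative_Pair_right: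
  assumes "(f has_derivative f') (at (x, y))"
  shows "((\<lambda>y. f (x, y)) has_derivative (\<lambda>v. f' (0, v))) (at y)"
  using diff_chain_at[OF has_derivative_Pair[OF has_derivative_const has_derivative_ident] assms]
  by (simp add: o_def)

text \<open>A directional derivative of a slice is a slice of a directional derivative, in direction
  \<open>(v, 0)\<close>, so the induction closes. The slices of group multiplication in coordinates
  give smoothness of left invariant fields (this lemma) and of left translations (the next
  one).\<close>

lemma Ck_on_Pair_left:
  assumes "open S" "Ck_on k S f"
  shows "Ck_on k {x. (x, y) \<in> S} (\<lambda>x. f (x, y))"
  using assms(2)
proof (induction k arbitrary: f)
  case 0
  then show ?case
    by (auto intro!: continuous_on_compose2[of S f] continuous_intros)
next
  case (Suc k)
  have op: "open {x. (x, y) \<in> S}"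
    using open_vimage[OF assms(1), of "\<lambda>x. (x, y)"] by (simp add: vimage_def continuous_intros)
  have der: "((\<lambda>x. f (x, y)) has_derivative (\<lambda>v. fderiv f (x, y) (v, 0))) (at x)"
    if "(x, y) \<in> S" for x
    using Suc.prems that by (intro has_derivative_Pair_left) (auto simp: frechet_derivative_works)
  have "Ck_on k {x. (x, y) \<in> S} (\<lambda>x. fderiv (\<lambda>x. f (x, y)) x v)" for v
  proof (rule Ck_on_cong[OF op])
    show "Ck_on k {x. (x, y) \<in> S} (\<lambda>x. fderiv f (x, y) (v, 0))"
      using Suc.prems by (intro Suc.IH) simp
  qed (simp add: fderiv_eqI[OF der])
  then show ?case using der by (auto simp: differentiable_def)
qed

lemma Ck_on_Pair_right:
  assumes "open S" "Ck_on k S f"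
  shows "Ck_on k {y. (x, y) \<in> S} (\<lambda>y. f (x, y))"
  using assms(2)
proof (induction k arbitrary: f)
  case 0
  then show ?case
    by (auto intro!: continuous_on_compose2[of S f] continuous_intros)
next
  case (Suc k)
  have op: "open {y. (x, y) \<in> S}"
    using open_vimage[OF assms(1), of "\<lambda>y. (x, y)"] by (simp add: vimage_def continuous_intros)
  have der: "((\<lambda>y. f (x, y)) has_derivative (\<lambda>v. fderiv f (x, y) (0, v))) (at y)"
    if "(x, y) \<in> S" for y
    using Suc.prems that by (intro has_derivative_Pair_right) (auto simp: frechet_derivative_works)
  have "Ck_on k {y. (x, y) \<in> S} (\<lambda>y. fderiv (\<lambda>y. f (x, y)) y v)" for v
  proof (rule Ck_on_cong[OF op])
    show "Ck_on k {y. (x, y) \<in> S} (\<lambda>y. fderiv f (x, y) (0, v))"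
      using Suc.prems by (intro Suc.IH) simp
  qed (simp add: fderiv_eqI[OF der])
  then show ?case using der by (auto simp: differentiable_def)
qed

lemma smooth_on_Pair_left:
  "open S \<Longrightarrow> smooth_on S f \<Longrightarrow> smooth_on {x. (x, y) \<in> S} (\<lambda>x. f (x, y))"
  unfolding smooth_on_def using Ck_on_Pair_left by blast

lemma smooth_on_Pair_right:
  "open S \<Longrightarrow> smooth_on S f \<Longrightarrow> smooth_on {y. (x, y) \<in> S} (\<lambda>y. f (x, y))"
  unfolding smooth_on_def using Ck_on_Pair_right by blast

section \<open>Symmetry of second derivatives\<close>

lemma fderiv_along_line:
  fixes f :: "'a::real_normed_vector \<Rightarrow> real"
  assumes "f differentiable (at (a + s *\<^sub>R u))"
  shows "((\<lambda>s. f (a + s *\<^sub>R u)) has_real_derivative fderiv f (a + s *\<^sub>R u) u) (at s)"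
proof -
  have "((\<lambda>s. f (a + s *\<^sub>R u)) has_derivative (\<lambda>t. fderiv f (a + s *\<^sub>R u) (t *\<^sub>R u))) (at s)"
  proof -
    have "((\<lambda>s. a + s *\<^sub>R u) has_derivative (\<lambda>t. t *\<^sub>R u)) (at s)"
      by (auto intro!: derivative_eq_intros)
    from diff_chain_at[OF this assms[unfolded frechet_derivative_works]] show ?thesis
      by (simp add: o_def)
  qed
  then show ?thesis
    using linear_fderiv[OF assms]
    by (simp add: has_field_derivative_def linear_scale mult.commute[of _ "fderiv _ _ _"])
qed

text \<open>Two mean value theorems, one along \<open>u\<close> and one along \<open>v\<close>, turn
  the quotient into the mixed derivative at a point of the small parallelogram; continuity of that
  derivative gives the limit.\<close>

lemma second_difference_tendsto:
  fixes f :: "'a::real_normed_vector \<Rightarrow> real"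
  assumes "open S" "x \<in> S" "smooth_on S f"
  shows "((\<lambda>t. (f (x + t *\<^sub>R u + t *\<^sub>R v) - f (x + t *\<^sub>R u) - f (x + t *\<^sub>R v) + f x) / t\<^sup>2)
          \<longlongrightarrow> fderiv (\<lambda>y. fderiv f y u) x v) (at_right 0)"
proof (rule tendstoI)
  fix e :: real assume "e > 0"
  define h where "h = (\<lambda>y. fderiv (\<lambda>y. fderiv f y u) y v)"
  have "continuous_on S h" unfolding h_def
    using assms by (intro smooth_on_continuous_on smooth_on_fderiv)
  then obtain d1 where d1: "d1 > 0" "\<And>y. y \<in> S \<Longrightarrow> dist y x < d1 \<Longrightarrow> dist (h y) (h x) < e"
    using \<open>e > 0\<close> assms(2) by (metis continuous_on_iff)
  obtain d2 where d2: "d2 > 0" "\<And>y. dist y x < d2 \<Longrightarrow> y \<in> S"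
    using assms(1,2) open_dist by metis
  \<comment> \<open>Chosen so that parallelograms with parameters below \<open>d\<close> stay in
    \<open>S\<close> and where the mixed derivative varies by less than \<open>e\<close>. The
    summand 1 makes the estimate strict and covers \<open>u = v = 0\<close>.\<close>
  define d where "d = min d1 d2 / (norm u + norm v + 1)"
  have "d > 0" unfolding d_def using d1 d2 by (simp add: add_nonneg_pos)
  have near: "dist (x + s *\<^sub>R u + t *\<^sub>R v) x < min d1 d2" if "0 \<le> s" "s < d" "0 \<le> t" "t < d" for s t
  proof -
    have "dist (x + s *\<^sub>R u + t *\<^sub>R v) x = norm (s *\<^sub>R u + t *\<^sub>R v)"
      by (simp add: dist_norm algebra_simps)
    also have "\<dots> \<le> norm (s *\<^sub>R u) + norm (t *\<^sub>R v)" by (rule norm_triangle_ineq)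
    also have "\<dots> \<le> d * norm u + d * norm v"
      using that by (auto intro!: add_mono mult_right_mono)
    also have "\<dots> < d * (norm u + norm v + 1)" using \<open>d > 0\<close> by (simp add: algebra_simps)
    also have "\<dots> = min d1 d2" unfolding d_def
      by (smt (verit) nonzero_eq_divide_eq norm_ge_zero)
    finally show ?thesis .
  qed
  show "\<forall>\<^sub>F t in at_right 0. dist ((f (x + t *\<^sub>R u + t *\<^sub>R v) - f (x + t *\<^sub>R u) - f (x + t *\<^sub>R v) + f x) / t\<^sup>2)
      (fderiv (\<lambda>y. fderiv f y u) x v) < e"
    unfolding eventually_at_right_field
  proof (intro exI[of _ d] conjI allI impI \<open>d > 0\<close>)
    fix t :: real assume t: "0 < t" "t < d"
    have inS: "x + s *\<^sub>R u + r *\<^sub>R v \<in> S" if "0 \<le> s" "s \<le> t" "0 \<le> r" "r \<le> t" for s r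
      using near[of s r] d2(2) that t by auto
    \<comment> \<open>The second difference is the increment over \<open>[0, t]\<close> of this
      function of \<open>s\<close>.\<close>
    have "((\<lambda>s. f (x + s *\<^sub>R u + t *\<^sub>R v) - f (x + s *\<^sub>R u)) has_real_derivative
        fderiv f (x + s *\<^sub>R u + t *\<^sub>R v) u - fderiv f (x + s *\<^sub>R u) u) (at s)" if "0 \<le> s" "s \<le> t" for s
    proof (rule DERIV_diff)
      show "((\<lambda>s. f (x + s *\<^sub>R u + t *\<^sub>R v)) has_real_derivative fderiv f (x + s *\<^sub>R u + t *\<^sub>R v) u) (at s)"
        using fderiv_along_line[of f "x + t *\<^sub>R v" s u]
          smooth_on_differentiable[OF assms(3) inS[of s t]] that t by (simp add: algebra_simps)
      show "((\<lambda>s. f (x + s *\<^sub>R u)) has_real_derivative fderiv f (x + s *\<^sub>R u) u) (at s)"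
        using fderiv_along_line[of f x s u]
          smooth_on_differentiable[OF assms(3) inS[of s 0]] that t by simp
    qed
    from MVT2[OF t(1) this] obtain s where s: "0 < s" "s < t"
      and s_eq: "f (x + t *\<^sub>R u + t *\<^sub>R v) - f (x + t *\<^sub>R u) - (f (x + t *\<^sub>R v) - f x)
        = t * (fderiv f (x + s *\<^sub>R u + t *\<^sub>R v) u - fderiv f (x + s *\<^sub>R u) u)"
      by auto
    have "((\<lambda>r. fderiv f (x + s *\<^sub>R u + r *\<^sub>R v) u) has_real_derivative h (x + s *\<^sub>R u + r *\<^sub>R v)) (at r)"
      if "0 \<le> r" "r \<le> t" for r
      unfolding h_def using that s
      by (intro fderiv_along_line smooth_on_differentiable[OF smooth_on_fderiv[OF assms(3)]] inS) auto
    from MVT2[OF t(1) this] obtain r where r: "0 < r" "r < t"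
      and r_eq: "fderiv f (x + s *\<^sub>R u + t *\<^sub>R v) u - fderiv f (x + s *\<^sub>R u) u
        = t * h (x + s *\<^sub>R u + r *\<^sub>R v)"
      by auto
    have "(f (x + t *\<^sub>R u + t *\<^sub>R v) - f (x + t *\<^sub>R u) - f (x + t *\<^sub>R v) + f x) / t\<^sup>2
        = h (x + s *\<^sub>R u + r *\<^sub>R v)"
      using s_eq r_eq t by (simp add: field_simps power2_eq_square)
    moreover have "dist (h (x + s *\<^sub>R u + r *\<^sub>R v)) (h x) < e"
      using d1(2)[of "x + s *\<^sub>R u + r *\<^sub>R v"] near[of s r] inS[of s r] s r t by auto
    ultimately show "dist ((f (x + t *\<^sub>R u + t *\<^sub>R v) - f (x + t *\<^sub>R u) - f (x + t *\<^sub>R v) + f x) / t\<^sup>2)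
      (fderiv (\<lambda>y. fderiv f y u) x v) < e" unfolding h_def by simp
  qed
qed

text \<open>The second difference is symmetric in \<open>u\<close> and \<open>v\<close>, so both
  mixed derivatives are limits of the same quotient.\<close>

lemma fderiv_commute_real:
  fixes f :: "'a::real_normed_vector \<Rightarrow> real"
  assumes "open S" "x \<in> S" "smooth_on S f"
  shows "fderiv (\<lambda>y. fderiv f y u) x v = fderiv (\<lambda>y. fderiv f y v) x u"
proof (rule tendsto_unique[OF _ second_difference_tendsto[OF assms]])
  show "((\<lambda>t. (f (x + t *\<^sub>R u + t *\<^sub>R v) - f (x + t *\<^sub>R u) - f (x + t *\<^sub>R v) + f x) / t\<^sup>2)
          \<longlongrightarrow> fderiv (\<lambda>y. fderiv f y v) x u) (at_right 0)"
    using second_difference_tendsto[OF assms, of v u] by (simp add: algebra_simps)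
qed simp

lemma fderiv_inner:
  assumes "f differentiable (at x)"
  shows "fderiv (\<lambda>y. f y \<bullet> z) x v = fderiv f x v \<bullet> z" "(\<lambda>y. f y \<bullet> z) differentiable (at x)"
proof -
  have "((\<lambda>y. f y \<bullet> z) has_derivative (\<lambda>v. fderiv f x v \<bullet> z)) (at x)"
    using assms by (auto simp: frechet_derivative_works intro: has_derivative_inner_left)
  then show "fderiv (\<lambda>y. f y \<bullet> z) x v = fderiv f x v \<bullet> z" "(\<lambda>y. f y \<bullet> z) differentiable (at x)"
    by (simp add: fderiv_eqI, auto simp: differentiable_def)
qed

lemma Ck_on_inner:
  assumes "open S" "Ck_on k S f"
  shows "Ck_on k S (\<lambda>y. f y \<bullet> z)"
  using assms(2)
proof (induction k arbitrary: f)
  case 0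
  then show ?case by (auto intro!: continuous_intros)
next
  case (Suc k)
  have "Ck_on k S (\<lambda>y. fderiv (\<lambda>y. f y \<bullet> z) y v)" for v
  proof (rule Ck_on_cong[OF assms(1)])
    show "Ck_on k S (\<lambda>y. fderiv f y v \<bullet> z)" using Suc by auto
  qed (use Suc.prems in \<open>auto simp: fderiv_inner\<close>)
  then show ?case using Suc.prems by (auto simp: fderiv_inner)
qed

text \<open>The mean value argument is for real values; vector values are tested against every
  \<open>z\<close>, and inner products separate points.\<close>

lemma fderiv_commute:
  fixes f :: "'a::real_normed_vector \<Rightarrow> 'b::real_inner"
  assumes "open S" "x \<in> S" "smooth_on S f"
  shows "fderiv (\<lambda>y. fderiv f y u) x v = fderiv (\<lambda>y. fderiv f y v) x u"
proof -
  have *: "fderiv (\<lambda>y. fderiv (\<lambda>y. f y \<bullet> z) y u) x v = fderiv (\<lambda>y. fderiv f y u) x v \<bullet> z" for z u v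
  proof -
    have "fderiv (\<lambda>y. fderiv (\<lambda>y. f y \<bullet> z) y u) x v = fderiv (\<lambda>y. fderiv f y u \<bullet> z) x v"
      using fderiv_cong_open[OF assms(1,2), of "\<lambda>y. fderiv (\<lambda>y. f y \<bullet> z) y u" "\<lambda>y. fderiv f y u \<bullet> z"]
        fderiv_inner(1)[OF smooth_on_differentiable[OF assms(3)]] by simp
    also have "\<dots> = fderiv (\<lambda>y. fderiv f y u) x v \<bullet> z"
      by (intro fderiv_inner(1) smooth_on_differentiable[OF smooth_on_fderiv[OF assms(3)] assms(2)])
    finally show ?thesis .
  qed
  have "smooth_on S (\<lambda>y. f y \<bullet> z)" for z
    using assms Ck_on_inner unfolding smooth_on_def by blast
  from fderiv_commute_real[OF assms(1,2) this] show ?thesis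
    by (metis * vector_eq_rdot)
qed

section \<open>Inner products on finite-dimensional subspaces\<close>

text \<open>Tangent spaces are subspaces of a function type and carry a metric only on a carrier,
  hence the set \<open>V\<close>. The instances are tangent spaces, Lie algebras, and the model
  space with its own inner product or with the metric in coordinates at one point.\<close>

locale inner_product_on =
  fixes V :: "'v::real_vector set" and g :: "'v \<Rightarrow> 'v \<Rightarrow> real"
  assumes finite_span: "\<exists>T. finite T \<and> T \<subseteq> V \<and> span T = V"
    and add_left: "\<lbrakk>u \<in> V; v \<in> V; w \<in> V\<rbrakk> \<Longrightarrow> g (u + v) w = g u w + g v w"
    and scale_left: "\<lbrakk>u \<in> V; w \<in> V\<rbrakk> \<Longrightarrow> g (r *\<^sub>R u) w = r * g u w"
    and sym: "\<lbrakk>u \<in> V; v \<in> V\<rbrakk> \<Longrightarrow> g u v = g v u"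
    and pos: "\<lbrakk>u \<in> V; u \<noteq> 0\<rbrakk> \<Longrightarrow> g u u > 0"
begin

lemma subspace_V: "subspace V"
  using finite_span subspace_span by metis

lemma zero_left: "w \<in> V \<Longrightarrow> g 0 w = 0"
  using scale_left[of 0 w 0] subspace_0[OF subspace_V] by simp

lemma diff_left: "\<lbrakk>u \<in> V; v \<in> V; w \<in> V\<rbrakk> \<Longrightarrow> g (u - v) w = g u w - g v w"
  using add_left[of "u - v" v w] subspace_diff[OF subspace_V] by simp

lemma sum_left:
  "(\<And>i. i \<in> I \<Longrightarrow> f i \<in> V) \<Longrightarrow> w \<in> V \<Longrightarrow> g (\<Sum>i\<in>I. c i *\<^sub>R f i) w = (\<Sum>i\<in>I. c i * g (f i) w)"
proof (induction I rule: infinite_finite_induct)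
  case (insert i I)
  have "(\<Sum>i\<in>I. c i *\<^sub>R f i) \<in> V"
    using insert.prems by (auto intro!: subspace_sum subspace_scale subspace_V)
  then show ?case using insert subspace_scale[OF subspace_V] by (simp add: add_left scale_left)
qed (simp_all add: zero_left)

lemma eqI:
  assumes "u \<in> V" "v \<in> V" "\<And>z. z \<in> V \<Longrightarrow> g u z = g v z"
  shows "u = v"
proof (rule ccontr)
  assume "u \<noteq> v"
  then have "g (u - v) (u - v) > 0" using assms pos subspace_diff[OF subspace_V] by simp
  moreover have "g (u - v) (u - v) = 0" using assms diff_left subspace_diff[OF subspace_V] by simp
  ultimately show False by simp
qed

definition orthonormal :: "'v set \<Rightarrow> bool"
  where "orthonormal E \<longleftrightarrow> finite E \<and> E \<subseteq> V \<and>
    (\<forall>u\<in>E. \<forall>v\<in>E. g u v = (if u = v then 1 else 0)) \<and> span E = V"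

text \<open>\<open>T\<close> may be linearly dependent: a vector with zero component orthogonal to
  the earlier ones adds nothing to the basis.\<close>

lemma Gram_Schmidt:
  assumes "finite T" "T \<subseteq> V"
  shows "\<exists>E. finite E \<and> E \<subseteq> V \<and> (\<forall>u\<in>E. \<forall>v\<in>E. g u v = (if u = v then 1 else 0)) \<and> span E = span T"
  using assms
proof (induction T)
  case empty
  then show ?case by (intro exI[of _ "{}"]) simp
next
  case (insert a T)
  then obtain E where E: "finite E" "E \<subseteq> V" "\<forall>u\<in>E. \<forall>v\<in>E. g u v = (if u = v then 1 else 0)"
    "span E = span T" by auto
  define s where "s = (\<Sum>e\<in>E. g a e *\<^sub>R e)"
  define w where "w = a - s"
  have aV: "a \<in> V" using insert.prems by simp
  have s: "s \<in> span E" unfolding s_def by (rule span_sum) (simp add: span_base span_scale)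
  have sV: "s \<in> V" unfolding s_def using E(2) by (auto intro!: subspace_sum subspace_scale subspace_V)
  have wV: "w \<in> V" unfolding w_def using aV sV subspace_diff[OF subspace_V] by simp
  have ins: "span (insert a E) = span (insert a T)"
    using E(4) by (auto simp: span_insert)
  show ?case
  proof (cases "w = 0")
    case True
    then have "a \<in> span E" using s w_def by simp
    then have "span (insert a E) = span E" by (rule span_redundant)
    then show ?thesis using E ins by metis
  next
    case False
    define c where "c = 1 / sqrt (g w w)"
    have gw: "g w w > 0" using pos wV False by simp
    then have c: "c \<noteq> 0" by (simp add: c_def)
    have cwV: "c *\<^sub>R w \<in> V" using wV subspace_scale[OF subspace_V] by simp
    have orth: "g w e = 0" if "e \<in> E" for e
    proof -
      have "g s e = (\<Sum>d\<in>E. g a d * g d e)"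
        unfolding s_def using E(2) that by (intro sum_left) auto
      also have "\<dots> = (\<Sum>d\<in>E. if d = e then g a e else 0)"
        using E(3) that by (intro sum.cong) auto
      also have "\<dots> = g a e" using E(1) that by simp
      finally show ?thesis unfolding w_def using diff_left aV sV E(2) that by auto
    qed
    have unit: "g (c *\<^sub>R w) (c *\<^sub>R w) = 1"
    proof -
      have "g (c *\<^sub>R w) (c *\<^sub>R w) = c * (c * g w w)"
        using scale_left[OF wV cwV] scale_left[OF wV wV] sym[OF wV cwV] by simp
      then show ?thesis using gw by (simp add: c_def)
    qed
    have orth': "g (c *\<^sub>R w) e = 0" "g e (c *\<^sub>R w) = 0" if "e \<in> E" for e
    proof -
      have eV: "e \<in> V" using E(2) that by auto
      show "g (c *\<^sub>R w) e = 0" using scale_left[OF wV eV] orth[OF that] by simp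
      then show "g e (c *\<^sub>R w) = 0" using sym[OF eV cwV] by simp
    qed
    have nE: "c *\<^sub>R w \<notin> E" using unit orth' by force
    have "a = w + s" by (simp add: w_def)
    then have a: "a = inverse c *\<^sub>R (c *\<^sub>R w) + s" using c by simp
    have "s \<in> span (insert (c *\<^sub>R w) E)"
      using s span_mono[of E "insert (c *\<^sub>R w) E"] by auto
    then have "a \<in> span (insert (c *\<^sub>R w) E)"
      by (subst a) (rule span_add[OF span_scale[OF span_base]], auto)
    moreover have "c *\<^sub>R w \<in> span (insert a E)"
      unfolding w_def using s span_mono[of E "insert a E"] span_base[of a "insert a E"]
      by (intro span_scale span_diff) auto
    ultimately have "span (insert (c *\<^sub>R w) E) = span (insert a E)"
      by (intro span_eq[THEN iffD2]) (auto intro: span_base)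
    then show ?thesis
      using E nE unit orth' cwV ins
      by (intro exI[of _ "insert (c *\<^sub>R w) E"]) auto
  qed
qed

lemma orthonormal_exists: "\<exists>E. orthonormal E"
  unfolding orthonormal_def using finite_span Gram_Schmidt by metis

lemma orthonormal_expand:
  assumes E: "orthonormal E" and x: "x \<in> V"
  shows "(\<Sum>e\<in>E. g x e *\<^sub>R e) = x"
proof -
  have E': "finite E" "E \<subseteq> V" "\<forall>u\<in>E. \<forall>v\<in>E. g u v = (if u = v then 1 else 0)" "span E = V"
    using E unfolding orthonormal_def by auto
  obtain c where c: "x = (\<Sum>e\<in>E. c e *\<^sub>R e)"
    using x E'(4) span_finite[OF E'(1)] by auto
  have "g x e = c e" if "e \<in> E" for e
  proof -
    have "g x e = (\<Sum>d\<in>E. c d * g d e)" unfolding c using E'(2) that by (intro sum_left) auto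
    also have "\<dots> = (\<Sum>d\<in>E. if d = e then c e else 0)" using E'(3) that by (intro sum.cong) auto
    also have "\<dots> = c e" using E'(1) that by simp
    finally show ?thesis .
  qed
  then show ?thesis unfolding c by (intro sum.cong) auto
qed

text \<open>Needed for the existence half of the definite description in
  \<open>christoffel\<close>.\<close>

lemma Riesz:
  assumes add: "\<And>u v. u \<in> V \<Longrightarrow> v \<in> V \<Longrightarrow> R (u + v) = R u + R v"
    and scale: "\<And>r u. u \<in> V \<Longrightarrow> R (r *\<^sub>R u) = r * R u"
  shows "\<exists>w\<in>V. \<forall>z\<in>V. g w z = R z"
proof -
  obtain E where E: "orthonormal E" using orthonormal_exists by blast
  then have EV: "E \<subseteq> V" unfolding orthonormal_def by auto
  define w where "w = (\<Sum>e\<in>E. R e *\<^sub>R e)"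
  have "w \<in> V" unfolding w_def using EV by (auto intro!: subspace_sum subspace_scale subspace_V)
  moreover have "g w z = R z" if z: "z \<in> V" for z
  proof -
    have R_sum: "R (\<Sum>e\<in>I. c e *\<^sub>R e) = (\<Sum>e\<in>I. c e * R e)" if "I \<subseteq> V" for I c
      using that
    proof (induction I rule: infinite_finite_induct)
      case (insert i I)
      have "(\<Sum>e\<in>I. c e *\<^sub>R e) \<in> V"
        using insert.prems by (auto intro!: subspace_sum subspace_scale subspace_V)
      then show ?case using insert subspace_scale[OF subspace_V] by (simp add: add scale)
    qed (use scale[of 0 0] subspace_0[OF subspace_V] in simp_all)
    have "R z = R (\<Sum>e\<in>E. g z e *\<^sub>R e)" using orthonormal_expand[OF E z] by simp
    also have "\<dots> = (\<Sum>e\<in>E. g z e * R e)" by (rule R_sum[OF EV])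
    also have "\<dots> = (\<Sum>e\<in>E. R e * g e z)" using sym z EV by (intro sum.cong) auto
    also have "\<dots> = g w z" unfolding w_def using EV z by (intro sum_left[symmetric]) auto
    finally show ?thesis by simp
  qed
  ultimately show ?thesis by blast
qed

text \<open>Both sides are the double sum over \<open>e\<close> and \<open>f\<close> of
  \<open>g (T e) f * g (S f) e\<close>, a product of matrix entries.\<close>

lemma trace_commute:
  assumes E: "orthonormal E"
    and S: "\<And>x. x \<in> V \<Longrightarrow> S x \<in> V" "\<And>x y. x \<in> V \<Longrightarrow> y \<in> V \<Longrightarrow> S (x + y) = S x + S y"
      "\<And>r x. x \<in> V \<Longrightarrow> S (r *\<^sub>R x) = r *\<^sub>R S x"
    and T: "\<And>x. x \<in> V \<Longrightarrow> T x \<in> V" "\<And>x y. x \<in> V \<Longrightarrow> y \<in> V \<Longrightarrow> T (x + y) = T x + T y"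
      "\<And>r x. x \<in> V \<Longrightarrow> T (r *\<^sub>R x) = r *\<^sub>R T x"
  shows "(\<Sum>e\<in>E. g (S (T e)) e) = (\<Sum>e\<in>E. g (T (S e)) e)"
proof -
  have EV: "e \<in> E \<Longrightarrow> e \<in> V" for e using E unfolding orthonormal_def by auto
  \<comment> \<open>\<open>S\<close> and \<open>T\<close> are generalised here so that both orders
    of composition are instances.\<close>
  have *: "(\<Sum>e\<in>E. g (S (T e)) e) = (\<Sum>e\<in>E. \<Sum>f\<in>E. g (T e) f * g (S f) e)"
    if S: "\<And>x. x \<in> V \<Longrightarrow> S x \<in> V" "\<And>x y. x \<in> V \<Longrightarrow> y \<in> V \<Longrightarrow> S (x + y) = S x + S y"
      "\<And>r x. x \<in> V \<Longrightarrow> S (r *\<^sub>R x) = r *\<^sub>R S x" and T: "\<And>x. x \<in> V \<Longrightarrow> T x \<in> V" for S T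
  proof (rule sum.cong)
    fix e assume e: "e \<in> E"
    have S_sum: "S (\<Sum>f\<in>I. c f *\<^sub>R f) = (\<Sum>f\<in>I. c f *\<^sub>R S f)" if "I \<subseteq> V" for I c
      using that
    proof (induction I rule: infinite_finite_induct)
      case (insert i I)
      have "(\<Sum>e\<in>I. c e *\<^sub>R e) \<in> V"
        using insert.prems by (auto intro!: subspace_sum subspace_scale subspace_V)
      then show ?case using insert subspace_scale[OF subspace_V] by (simp add: S)
    qed (use S(3)[of 0 0] subspace_0[OF subspace_V] in simp_all)
    have "S (T e) = S (\<Sum>f\<in>E. g (T e) f *\<^sub>R f)" using orthonormal_expand[OF E T] e EV by simp
    also have "\<dots> = (\<Sum>f\<in>E. g (T e) f *\<^sub>R S f)" using EV by (intro S_sum) auto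
    finally show "g (S (T e)) e = (\<Sum>f\<in>E. g (T e) f * g (S f) e)"
      using e EV S(1) by (simp add: sum_left)
  qed simp
  have "(\<Sum>e\<in>E. g (S (T e)) e) = (\<Sum>e\<in>E. \<Sum>f\<in>E. g (T e) f * g (S f) e)"
    using S T(1) by (rule *)
  also have "\<dots> = (\<Sum>f\<in>E. \<Sum>e\<in>E. g (S f) e * g (T e) f)"
    by (subst sum.swap) (simp add: mult.commute)
  also have "\<dots> = (\<Sum>e\<in>E. g (T (S e)) e)"
    using T S(1) by (rule *[symmetric])
  finally show ?thesis .
qed

end

text \<open>A model space comes with an inner product and a finite spanning set but no fixed
  \<open>Basis\<close>; this supplies one, dimension 0 included.\<close>

lemma orthonormal_basis_inner:
  assumes "\<exists>T::'b::real_inner set. finite T \<and> span T = UNIV"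
  obtains B :: "'b::real_inner set" where "finite B" "\<And>x. (\<Sum>b\<in>B. (x \<bullet> b) *\<^sub>R b) = x"
proof -
  interpret inner_product_on "UNIV :: 'b set" inner
    using assms by unfold_locales (auto simp: inner_add_left inner_add_right inner_commute)
  obtain B where "orthonormal B" using orthonormal_exists by blast
  then show ?thesis using that orthonormal_expand unfolding orthonormal_def by blast
qed

text \<open>Finiteness of the dimension makes up for the lack of joint regularity of \<open>B\<close>.\<close>

lemma has_derivative_linear_family:
  fixes B :: "'a::real_normed_vector \<Rightarrow> 'b::real_inner \<Rightarrow> 'c::real_normed_vector"
  assumes fin: "\<exists>T::'b set. finite T \<and> span T = UNIV"
    and S: "open S" "x \<in> S"
    and lin: "\<And>y. y \<in> S \<Longrightarrow> linear (B y)"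
    and diff: "\<And>b. (\<lambda>y. B y b) differentiable (at x)"
    and V: "(V has_derivative V') (at x)"
  shows "((\<lambda>y. B y (V y)) has_derivative (\<lambda>v. fderiv (\<lambda>y. B y (V x)) x v + B x (V' v))) (at x)"
proof -
  obtain T :: "'b set" where T: "finite T" "\<And>x. (\<Sum>b\<in>T. (x \<bullet> b) *\<^sub>R b) = x"
    by (rule orthonormal_basis_inner[OF fin]) (rule that)
  \<comment> \<open>In an orthonormal basis \<open>B y (V y)\<close> is a finite sum of scalars
    \<open>V y \<bullet> b\<close> times vectors \<open>B y b\<close>, and the product rule applies
    term by term with \<open>b\<close> fixed.\<close>
  have expand: "B y w = (\<Sum>b\<in>T. (w \<bullet> b) *\<^sub>R B y b)" if "y \<in> S" for y w
    by (subst T(2)[symmetric, of w]) (simp add: linear_sum[OF lin[OF that]] linear_scale[OF lin[OF that]])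
  have d: "((\<lambda>y. B y b) has_derivative fderiv (\<lambda>y. B y b) x) (at x)" for b
    using diff frechet_derivative_works by blast
  have "((\<lambda>y. \<Sum>b\<in>T. (w \<bullet> b) *\<^sub>R B y b) has_derivative
      (\<lambda>v. \<Sum>b\<in>T. (w \<bullet> b) *\<^sub>R fderiv (\<lambda>y. B y b) x v)) (at x)" for w
    by (intro has_derivative_sum has_derivative_scaleR_right d)
  then have "((\<lambda>y. B y w) has_derivative
      (\<lambda>v. \<Sum>b\<in>T. (w \<bullet> b) *\<^sub>R fderiv (\<lambda>y. B y b) x v)) (at x)" for w
    by (rule has_derivative_transform_within_open[OF _ S]) (rule expand[symmetric])
  then have part: "fderiv (\<lambda>y. B y w) x v = (\<Sum>b\<in>T. (w \<bullet> b) *\<^sub>R fderiv (\<lambda>y. B y b) x v)" for w v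
    by (rule fun_cong[OF fderiv_eqI])
  have "((\<lambda>y. \<Sum>b\<in>T. (V y \<bullet> b) *\<^sub>R B y b) has_derivative
      (\<lambda>v. \<Sum>b\<in>T. (V x \<bullet> b) *\<^sub>R fderiv (\<lambda>y. B y b) x v + (V' v \<bullet> b) *\<^sub>R B x b)) (at x)"
    by (intro has_derivative_sum has_derivative_scaleR has_derivative_inner_left V d)
  then have "((\<lambda>y. B y (V y)) has_derivative
      (\<lambda>v. \<Sum>b\<in>T. (V x \<bullet> b) *\<^sub>R fderiv (\<lambda>y. B y b) x v + (V' v \<bullet> b) *\<^sub>R B x b)) (at x)"
    by (rule has_derivative_transform_within_open[OF _ S]) (rule expand[symmetric])
  then show ?thesis
    by (subst part, subst expand[OF S(2)]) (simp add: sum.distrib)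
qed

section \<open>Traces of adjoint maps\<close>

text \<open>The Jacobi identity is written as the derivation property of \<open>br x\<close>, the
  form in which both trace lemmas use it.\<close>

locale lie_algebra_on =
  fixes L :: "'v::real_vector set" and br :: "'v \<Rightarrow> 'v \<Rightarrow> 'v"
  assumes subspace_L: "subspace L"
    and closed: "\<lbrakk>x \<in> L; y \<in> L\<rbrakk> \<Longrightarrow> br x y \<in> L"
    and add_l: "\<lbrakk>x \<in> L; y \<in> L; z \<in> L\<rbrakk> \<Longrightarrow> br (x + y) z = br x z + br y z"
    and scale_l: "\<lbrakk>x \<in> L; y \<in> L\<rbrakk> \<Longrightarrow> br (r *\<^sub>R x) y = r *\<^sub>R br x y"
    and antisym: "\<lbrakk>x \<in> L; y \<in> L\<rbrakk> \<Longrightarrow> br x y = - br y x"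
    and Jacobi: "\<lbrakk>x \<in> L; y \<in> L; z \<in> L\<rbrakk> \<Longrightarrow> br x (br y z) = br (br x y) z + br y (br x z)"
begin

lemma add_r:
  assumes "x \<in> L" "y \<in> L" "z \<in> L"
  shows "br x (y + z) = br x y + br x z"
proof -
  have "br x (y + z) = - br (y + z) x" using assms subspace_add[OF subspace_L] by (intro antisym)
  also have "\<dots> = - br y x - br z x" using assms by (simp add: add_l)
  also have "\<dots> = br x y + br x z" using assms antisym[of x y] antisym[of x z] by simp
  finally show ?thesis .
qed

lemma scale_r:
  assumes "x \<in> L" "y \<in> L"
  shows "br x (r *\<^sub>R y) = r *\<^sub>R br x y"
proof -
  have "br x (r *\<^sub>R y) = - br (r *\<^sub>R y) x" using assms subspace_scale[OF subspace_L] by (intro antisym)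
  also have "\<dots> = r *\<^sub>R br x y" using assms antisym[of x y] by (simp add: scale_l)
  finally show ?thesis .
qed

lemma trace_ad_eq_0:
  assumes "inner_product_on L g" and E: "inner_product_on.orthonormal L g E"
    and perfect: "derived_algebra L br = L" and a: "a \<in> L"
  shows "(\<Sum>e\<in>E. g (br a e) e) = 0"
proof -
  interpret inner_product_on L g by fact
  have EL: "E \<subseteq> L" using E unfolding orthonormal_def by simp
  have comm: "(\<Sum>e\<in>E. g (br (br x y) e) e) = 0" if "x \<in> L" "y \<in> L" for x y
  proof -
    have "(\<Sum>e\<in>E. g (br (br x y) e) e) = (\<Sum>e\<in>E. g (br x (br y e)) e - g (br y (br x e)) e)"
    proof (rule sum.cong)
      fix e assume "e \<in> E"
      then have e: "e \<in> L" using EL by auto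
      have "br (br x y) e = br x (br y e) - br y (br x e)" using Jacobi[OF that e] by simp
      then show "g (br (br x y) e) e = g (br x (br y e)) e - g (br y (br x e)) e"
        using that e by (simp add: closed diff_left)
    qed simp
    also have "\<dots> = (\<Sum>e\<in>E. g (br x (br y e)) e) - (\<Sum>e\<in>E. g (br y (br x e)) e)"
      by (rule sum_subtractf)
    also have "(\<Sum>e\<in>E. g (br x (br y e)) e) = (\<Sum>e\<in>E. g (br y (br x e)) e)"
      using that by (intro trace_commute[OF E]) (auto simp: closed add_r scale_r)
    finally show ?thesis by simp
  qed
  have "a \<in> span {br x y |x y. x \<in> L \<and> y \<in> L}"
    using a perfect unfolding derived_algebra_def by simp
  \<comment> \<open>Membership in \<open>L\<close> is carried through the induction because
    \<open>br\<close> and \<open>g\<close> are linear only on \<open>L\<close>.\<close>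
  then have "a \<in> L \<and> (\<Sum>e\<in>E. g (br a e) e) = 0"
  proof (induction rule: span_induct_alt)
    case base
    have "g (br 0 e) e = 0" if "e \<in> E" for e
      using that EL scale_l[of 0 e 0] subspace_0[OF subspace_L] zero_left by auto
    then show ?case using subspace_0[OF subspace_L] by simp
  next
    case (step c u v)
    then obtain x y where u: "u = br x y" "x \<in> L" "y \<in> L" by auto
    then have uL: "u \<in> L" by (simp add: closed)
    have "g (br (c *\<^sub>R u + v) e) e = c * g (br u e) e + g (br v e) e" if "e \<in> E" for e
      using that EL step uL subspace_scale[OF subspace_L]
      by (simp add: add_l scale_l closed add_left scale_left subset_iff)
    then have "(\<Sum>e\<in>E. g (br (c *\<^sub>R u + v) e) e)
        = c * (\<Sum>e\<in>E. g (br u e) e) + (\<Sum>e\<in>E. g (br v e) e)"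
      by (simp add: sum.distrib sum_distrib_left)
    then show ?case
      using step uL u comm subspace_add[OF subspace_L] subspace_scale[OF subspace_L] by auto
  qed
  then show ?thesis by simp
qed

end

text \<open>Pulled back along \<open>\<xi>\<close>, the restriction of \<open>ad w\<close> to the ideal \<open>\<xi> ` L\<close> is a derivation of
  \<open>L\<close>, hence inner.\<close>

lemma trace_ad_ideal_eq_0:
  assumes L: "lie_algebra_on L br" and L': "lie_algebra_on L' br'"
    and g: "inner_product_on L g" and E: "inner_product_on.orthonormal L g E"
    and \<xi>: "\<And>x. x \<in> L \<Longrightarrow> \<xi> x \<in> L'" "inj_on \<xi> L"
      "\<And>x y. x \<in> L \<Longrightarrow> y \<in> L \<Longrightarrow> \<xi> (x + y) = \<xi> x + \<xi> y"
      "\<And>r x. x \<in> L \<Longrightarrow> \<xi> (r *\<^sub>R x) = r *\<^sub>R \<xi> x"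
      "\<And>x y. x \<in> L \<Longrightarrow> y \<in> L \<Longrightarrow> \<xi> (br x y) = br' (\<xi> x) (\<xi> y)"
    and iso: "\<And>x y. x \<in> L \<Longrightarrow> y \<in> L \<Longrightarrow> h (\<xi> x) (\<xi> y) = g x y"
    and perfect: "derived_algebra L br = L"
    and inner: "\<And>D. lie_derivation L br D \<Longrightarrow> inner_derivation L br D"
    and ideal: "lie_ideal L' br' (\<xi> ` L)"
    and w: "w \<in> L'"
  shows "(\<Sum>e\<in>E. h (br' w (\<xi> e)) (\<xi> e)) = 0"
proof -
  interpret L: lie_algebra_on L br by fact
  interpret L': lie_algebra_on L' br' by fact
  interpret inner_product_on L g by fact
  have EL: "E \<subseteq> L" using E unfolding orthonormal_def by simp
  define D where "D = (\<lambda>x. inv_into L \<xi> (br' w (\<xi> x)))"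
  have mem: "br' w (\<xi> x) \<in> \<xi> ` L" if "x \<in> L" for x
    using ideal w that unfolding lie_ideal_def by blast
  have D: "D x \<in> L" "\<xi> (D x) = br' w (\<xi> x)" if "x \<in> L" for x
    unfolding D_def using mem[OF that] by (auto intro: inv_into_into f_inv_into_f)
  \<comment> \<open>Each derivation law for \<open>D\<close> is checked after applying
    \<open>\<xi>\<close>, where it becomes a law of \<open>br' w\<close> on the target
    algebra.\<close>
  have \<xi>_eqI: "x = y" if "\<xi> x = \<xi> y" "x \<in> L" "y \<in> L" for x y
    using that \<xi>(2) by (auto dest: inj_onD)
  have "lie_derivation L br D"
    unfolding lie_derivation_def
  proof (intro conjI ballI allI)
    fix x y r assume x: "x \<in> L" and y: "y \<in> L"
    show "D (x + y) = D x + D y"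
    proof (rule \<xi>_eqI)
      show "\<xi> (D (x + y)) = \<xi> (D x + D y)"
        using x y D \<xi> w L'.add_r subspace_add[OF L.subspace_L] by simp
    qed (use x y D in \<open>auto intro!: subspace_add L.subspace_L\<close>)
    show "D (br x y) = br (D x) y + br x (D y)"
    proof (rule \<xi>_eqI)
      show "\<xi> (D (br x y)) = \<xi> (br (D x) y + br x (D y))"
        using x y D \<xi> w L.closed L'.Jacobi[of w "\<xi> x" "\<xi> y"] by simp
    qed (use x y D L.closed in \<open>auto intro!: subspace_add L.subspace_L\<close>)
  next
    fix r x assume x: "x \<in> L"
    show "D (r *\<^sub>R x) = r *\<^sub>R D x"
    proof (rule \<xi>_eqI)
      show "\<xi> (D (r *\<^sub>R x)) = \<xi> (r *\<^sub>R D x)"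
        using x D \<xi> w L'.scale_r subspace_scale[OF L.subspace_L] by simp
    qed (use x D in \<open>auto intro!: subspace_scale L.subspace_L\<close>)
  qed (use D in auto)
  then obtain a where a: "a \<in> L" "\<And>x. x \<in> L \<Longrightarrow> D x = br a x"
    using inner unfolding inner_derivation_def by blast
  \<comment> \<open>As \<open>\<xi>\<close> is isometric, the trace over the ideal is that of
    \<open>D\<close>, which agrees on \<open>L\<close> with the adjoint map of
    \<open>a\<close>.\<close>
  have "(\<Sum>e\<in>E. h (br' w (\<xi> e)) (\<xi> e)) = (\<Sum>e\<in>E. g (br a e) e)"
  proof (rule sum.cong)
    fix e assume "e \<in> E"
    then have e: "e \<in> L" using EL by auto
    have "h (br' w (\<xi> e)) (\<xi> e) = h (\<xi> (D e)) (\<xi> e)" using D(2)[OF e] by simp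
    also have "\<dots> = g (br a e) e" using iso D(1)[OF e] e a by simp
    finally show "h (br' w (\<xi> e)) (\<xi> e) = g (br a e) e" .
  qed simp
  then show ?thesis using L.trace_ad_eq_0[OF g E perfect a(1)] by simp
qed

section \<open>Tangent vectors and differentials\<close>

abbreviation coord_dom :: "('m, 'e) chart \<Rightarrow> ('n, 'f) chart \<Rightarrow> ('m \<Rightarrow> 'n) \<Rightarrow> 'e set"
  where "coord_dom c d f \<equiv> snd c ` (fst c \<inter> f -` fst d)"

lemma charts_at_iff: "c \<in> charts_at A p \<longleftrightarrow> c \<in> A \<and> p \<in> fst c"
  unfolding charts_at_def by simp

context smooth_manifold
begin

lemma chart_at: "chart_at A p \<in> charts_at A p"
proof -
  have "\<exists>c. c \<in> charts_at A p" using cover unfolding charts_at_def by blast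
  then show ?thesis unfolding chart_at_def by (rule someI_ex)
qed

lemma chart_homeo: "c \<in> A \<Longrightarrow> homeomorphism (fst c) (snd c ` fst c) (snd c) (chart_inv c)"
  using charts unfolding is_chart_def by blast

lemma chart_inv_snd: "c \<in> A \<Longrightarrow> p \<in> fst c \<Longrightarrow> chart_inv c (snd c p) = p"
  using chart_homeo unfolding homeomorphism_def by blast

lemma chart_inv_in: "c \<in> A \<Longrightarrow> x \<in> snd c ` fst c \<Longrightarrow> chart_inv c x \<in> fst c"
  using chart_inv_snd by (metis imageE)

lemma snd_chart_inv: "c \<in> A \<Longrightarrow> x \<in> snd c ` fst c \<Longrightarrow> snd c (chart_inv c x) = x"
  using chart_inv_snd by (metis imageE)

lemma open_chart_image: "c \<in> A \<Longrightarrow> open (snd c ` fst c)"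
  using charts unfolding is_chart_def by blast

lemma open_image_chart:
  assumes "c \<in> A" "open U"
  shows "open (snd c ` (fst c \<inter> U))"
proof -
  have "snd c ` (fst c \<inter> U) = snd c ` fst c \<inter> chart_inv c -` U"
    using chart_inv_snd[OF assms(1)] by force
  moreover have "continuous_on (snd c ` fst c) (chart_inv c)"
    using chart_homeo[OF assms(1)] unfolding homeomorphism_def by blast
  ultimately show ?thesis
    using continuous_open_preimage[OF _ open_chart_image[OF assms(1)] assms(2)] by simp
qed

lemma smooth_map_id: "smooth_map A A (\<lambda>p. p)"
  unfolding smooth_map_def using compatible by (simp add: continuous_on_id)

lemma fderiv_coord_id:
  assumes "c \<in> charts_at A p"
  shows "fderiv (coord_map c c (\<lambda>q. q)) (snd c p) u = u"
proof -
  have c: "c \<in> A" "p \<in> fst c" using assms by (auto simp: charts_at_iff)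
  have "fderiv (coord_map c c (\<lambda>q. q)) (snd c p) = fderiv (\<lambda>x. x) (snd c p)"
    using c by (intro fderiv_cong_open[OF open_chart_image[OF c(1)]])
      (auto simp: coord_map_def chart_inv_snd)
  then show ?thesis by simp
qed

end

lemma smooth_on_coord_map:
  "smooth_map A B f \<Longrightarrow> c \<in> A \<Longrightarrow> d \<in> B \<Longrightarrow> smooth_on (coord_dom c d f) (coord_map c d f)"
  unfolding smooth_map_def by blast

lemma open_coord_dom:
  assumes A: "smooth_manifold A" and B: "smooth_manifold B" and f: "smooth_map A B f"
    and c: "c \<in> A" and d: "d \<in> B"
  shows "open (coord_dom c d f)"
proof -
  have "open (fst d)" using smooth_manifold.charts[OF B d] unfolding is_chart_def by blast
  then have "open (f -` fst d)"
    using f open_vimage unfolding smooth_map_def by blast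
  then show ?thesis by (rule smooth_manifold.open_image_chart[OF A c])
qed

lemma coord_map_differentiable:
  assumes "smooth_map A B f" "c \<in> charts_at A p" "d \<in> charts_at B (f p)"
  shows "coord_map c d f differentiable (at (snd c p))"
  using assms smooth_on_differentiable[of "coord_dom c d f" "coord_map c d f" "snd c p"]
  unfolding smooth_map_def charts_at_def by auto

text \<open>The local representatives compose only on \<open>coord_dom c d f\<close>, an open
  neighbourhood of \<open>snd c p\<close>, which is enough for derivatives. With \<open>f\<close> or
  \<open>g\<close> the identity this is also the change of chart rule, in the source or in the
  target.\<close>

lemma fderiv_coord_chain:
  assumes A: "smooth_manifold A" and B: "smooth_manifold B"
    and f: "smooth_map A B f" and g: "smooth_map B C g"
    and c: "c \<in> charts_at A p" and d: "d \<in> charts_at B (f p)" and e: "e \<in> charts_at C (g (f p))"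
  shows "fderiv (coord_map c e (\<lambda>q. g (f q))) (snd c p) u
    = fderiv (coord_map d e g) (snd d (f p)) (fderiv (coord_map c d f) (snd c p) u)"
proof -
  have c': "c \<in> A" "p \<in> fst c" and d': "d \<in> B" "f p \<in> fst d"
    using c d by (auto simp: charts_at_iff)
  have x: "coord_map c d f (snd c p) = snd d (f p)"
    using smooth_manifold.chart_inv_snd[OF A c'] by (simp add: coord_map_def)
  have "(coord_map c d f has_derivative fderiv (coord_map c d f) (snd c p)) (at (snd c p))"
    using coord_map_differentiable[OF f c d] frechet_derivative_works by blast
  moreover have "(coord_map d e g has_derivative fderiv (coord_map d e g) (snd d (f p)))
      (at (coord_map c d f (snd c p)))"
    unfolding x using coord_map_differentiable[OF g d e] frechet_derivative_works by blast
  ultimately have "fderiv (coord_map d e g \<circ> coord_map c d f) (snd c p)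
      = fderiv (coord_map d e g) (snd d (f p)) \<circ> fderiv (coord_map c d f) (snd c p)"
    by (intro fderiv_eqI diff_chain_at)
  moreover have "fderiv (coord_map d e g \<circ> coord_map c d f) (snd c p)
      = fderiv (coord_map c e (\<lambda>q. g (f q))) (snd c p)"
  proof (rule fderiv_cong_open)
    show "open (coord_dom c d f)" using open_coord_dom[OF A B f c'(1) d'(1)] .
    show "snd c p \<in> coord_dom c d f" using c' d' by auto
    fix y assume "y \<in> coord_dom c d f"
    then show "(coord_map d e g \<circ> coord_map c d f) y = coord_map c e (\<lambda>q. g (f q)) y"
      using smooth_manifold.chart_inv_snd[OF A c'(1)] smooth_manifold.chart_inv_snd[OF B d'(1)]
      by (auto simp: coord_map_def)
  qed
  ultimately show ?thesis by (metis comp_apply)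
qed

lemma tangent_change:
  "v \<in> tangent_space A p \<Longrightarrow> c \<in> charts_at A p \<Longrightarrow> d \<in> charts_at A p \<Longrightarrow>
    v d = fderiv (coord_map c d (\<lambda>q. q)) (snd c p) (v c)"
  unfolding tangent_space_def by blast

lemma tangent_outside: "v \<in> tangent_space A p \<Longrightarrow> c \<notin> charts_at A p \<Longrightarrow> v c = 0"
  unfolding tangent_space_def by blast

text \<open>Transition maps determine all components at charts around \<open>p\<close> from one of
  them, and the others are 0 by convention.\<close>

lemma tangent_eqI:
  assumes "v \<in> tangent_space A p" "w \<in> tangent_space A p" "c \<in> charts_at A p" "v c = w c"
  shows "v = w"
proof
  fix d
  show "v d = w d"
  proof (cases "d \<in> charts_at A p")
    case True
    then show ?thesis
      using tangent_change[OF assms(1,3) True] tangent_change[OF assms(2,3) True] assms(4) by simp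
  next
    case False
    then show ?thesis using tangent_outside assms by metis
  qed
qed

context smooth_manifold
begin

lemma coord_vector_same: "c \<in> charts_at A p \<Longrightarrow> coord_vector A c p u c = u"
  unfolding coord_vector_def by (simp add: fderiv_coord_id)

lemma coord_vector_in:
  assumes c: "c \<in> charts_at A p"
  shows "coord_vector A c p u \<in> tangent_space A p"
  unfolding tangent_space_def
proof (intro CollectI conjI ballI allI impI)
  fix d e assume de: "d \<in> charts_at A p" "e \<in> charts_at A p"
  show "coord_vector A c p u e
      = fderiv (coord_map d e (\<lambda>q. q)) (snd d p) (coord_vector A c p u d)"
    using fderiv_coord_chain[OF smooth_manifold_axioms smooth_manifold_axioms smooth_map_id
        smooth_map_id c, of d e u] de
    unfolding coord_vector_def by simp
qed (simp add: coord_vector_def)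

lemma coord_vector_eq:
  "v \<in> tangent_space A p \<Longrightarrow> c \<in> charts_at A p \<Longrightarrow> coord_vector A c p (v c) = v"
  using tangent_eqI[OF coord_vector_in] coord_vector_same by metis

lemma linear_transition:
  "c \<in> charts_at A p \<Longrightarrow> d \<in> charts_at A p \<Longrightarrow> linear (fderiv (coord_map c d (\<lambda>q. q)) (snd c p))"
  by (intro linear_fderiv coord_map_differentiable[OF smooth_map_id]) auto

lemma linear_coord_vector:
  assumes c: "c \<in> charts_at A p"
  shows "linear (coord_vector A c p)"
proof (rule linearI)
  fix u v r
  show "coord_vector A c p (u + v) = coord_vector A c p u + coord_vector A c p v"
    using linear_add[OF linear_transition[OF c]] by (auto simp: coord_vector_def fun_eq_iff)
  show "coord_vector A c p (r *\<^sub>R u) = r *\<^sub>R coord_vector A c p u"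
    using linear_scale[OF linear_transition[OF c]]
    by (auto simp: coord_vector_def fun_eq_iff scaleR_fun_def)
qed

lemma range_coord_vector:
  assumes c: "c \<in> charts_at A p"
  shows "range (coord_vector A c p) = tangent_space A p"
proof
  show "tangent_space A p \<subseteq> range (coord_vector A c p)"
    using coord_vector_eq[OF _ c] by (metis rangeI subsetI)
qed (use coord_vector_in[OF c] in auto)

text \<open>\<open>coord_vector\<close> for any chart around \<open>p\<close> is a linear map from
  the model space onto the tangent space.\<close>

lemma tangent_space_finite_span:
  "\<exists>T. finite T \<and> T \<subseteq> tangent_space A p \<and> span T = tangent_space A p"
proof -
  obtain B :: "'e set" where B: "finite B" "span B = UNIV" using finite_dim by blast
  let ?T = "coord_vector A (chart_at A p) p ` B"
  have "span ?T = tangent_space A p"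
    using span_linear_image[OF linear_coord_vector[OF chart_at], of p B] B(2)
      range_coord_vector[OF chart_at] by simp
  then show ?thesis using B(1) span_superset by (metis finite_imageI)
qed

lemma subspace_tangent_space: "subspace (tangent_space A p)"
  using tangent_space_finite_span subspace_span by metis

end

text \<open>\<open>differential\<close> reads its argument in the arbitrarily chosen
  \<open>chart_at A p\<close>; this frees later computations from that choice.\<close>

lemma differential_component:
  assumes A: "smooth_manifold A" and B: "smooth_manifold B" and f: "smooth_map A B f"
    and v: "v \<in> tangent_space A p" and c: "c \<in> charts_at A p" and d: "d \<in> charts_at B (f p)"
  shows "differential A B f p v d = fderiv (coord_map c d f) (snd c p) (v c)"
proof -
  have c0: "chart_at A p \<in> charts_at A p" by (rule smooth_manifold.chart_at[OF A])
  have "fderiv (coord_map c d f) (snd c p) (v c)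
      = fderiv (coord_map (chart_at A p) d f) (snd (chart_at A p) p) (v (chart_at A p))"
    using fderiv_coord_chain[OF A A smooth_manifold.smooth_map_id[OF A] f c c0 d]
    by (simp add: tangent_change[OF v c c0])
  then show ?thesis using d by (simp add: differential_def Let_def)
qed

lemma differential_in:
  assumes A: "smooth_manifold A" and B: "smooth_manifold B" and f: "smooth_map A B f"
    and v: "v \<in> tangent_space A p"
  shows "differential A B f p v \<in> tangent_space B (f p)"
  unfolding tangent_space_def
proof (intro CollectI conjI ballI allI impI)
  fix d e assume d: "d \<in> charts_at B (f p)" and e: "e \<in> charts_at B (f p)"
  have c: "chart_at A p \<in> charts_at A p" by (rule smooth_manifold.chart_at[OF A])
  show "differential A B f p v e
      = fderiv (coord_map d e (\<lambda>q. q)) (snd d (f p)) (differential A B f p v d)"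
    using fderiv_coord_chain[OF A B f smooth_manifold.smooth_map_id[OF B] c d e]
    by (simp add: differential_component[OF A B f v c] d e)
qed (simp add: differential_def)

lemma differential_chain:
  assumes A: "smooth_manifold A" and B: "smooth_manifold B" and C: "smooth_manifold C"
    and f: "smooth_map A B f" and g: "smooth_map B C g"
    and v: "v \<in> tangent_space A p"
  shows "differential A C (\<lambda>q. g (f q)) p v = differential B C g (f p) (differential A B f p v)"
proof
  fix e
  have c: "chart_at A p \<in> charts_at A p" by (rule smooth_manifold.chart_at[OF A])
  have d: "chart_at B (f p) \<in> charts_at B (f p)" by (rule smooth_manifold.chart_at[OF B])
  show "differential A C (\<lambda>q. g (f q)) p v e
      = differential B C g (f p) (differential A B f p v) e"
  proof (cases "e \<in> charts_at C (g (f p))")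
    case True
    then show ?thesis
      using fderiv_coord_chain[OF A B f g c d True]
      by (simp add: differential_component[OF A B f v c d]
          differential_component[OF B C g differential_in[OF A B f v] d])
         (simp add: differential_def Let_def)
  qed (simp add: differential_def)
qed

lemma (in smooth_manifold) differential_id:
  assumes "v \<in> tangent_space A p"
  shows "differential A A (\<lambda>q. q) p v = v"
  using smooth_manifold_axioms
  by (intro tangent_eqI[OF differential_in[OF _ _ smooth_map_id assms] assms chart_at])
     (simp_all add: differential_component[OF _ _ smooth_map_id assms chart_at]
        chart_at fderiv_coord_id)

text \<open>Linear on the whole function type and not just on the tangent space, since only one
  component of the argument is read.\<close>

lemma linear_differential:
  assumes "smooth_manifold A" and f: "smooth_map A B f"
  shows "linear (differential A B f p)"
proof -
  interpret smooth_manifold A by fact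
  have *: "linear (fderiv (coord_map (chart_at A p) d f) (snd (chart_at A p) p))"
    if "d \<in> charts_at B (f p)" for d
    using that by (intro linear_fderiv coord_map_differentiable[OF f chart_at])
  show ?thesis
    using linear_add[OF *] linear_scale[OF *]
    by (intro linearI) (auto simp: differential_def fun_eq_iff scaleR_fun_def Let_def)
qed

section \<open>Vector fields and their brackets\<close>

definition smooth_field ::
  "('m, 'e::real_normed_vector) chart set \<Rightarrow> ('m \<Rightarrow> ('m, 'e) tangent) \<Rightarrow> bool"
  where "smooth_field A X \<longleftrightarrow> (\<forall>p. X p \<in> tangent_space A p) \<and>
    (\<forall>c\<in>A. smooth_on (snd c ` fst c) (field_rep c X))"

definition field_related ::
  "('m, 'e::real_normed_vector) chart set \<Rightarrow> ('n, 'f::real_normed_vector) chart set \<Rightarrow>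
   ('m \<Rightarrow> 'n) \<Rightarrow> ('m \<Rightarrow> ('m, 'e) tangent) \<Rightarrow> ('n \<Rightarrow> ('n, 'f) tangent) \<Rightarrow> bool"
  where "field_related A B f X Y \<longleftrightarrow> (\<forall>p. differential A B f p (X p) = Y (f p))"

context smooth_manifold
begin

lemma field_rep_snd: "c \<in> charts_at A p \<Longrightarrow> field_rep c X (snd c p) = X p c"
  by (simp add: field_rep_def chart_inv_snd charts_at_iff)

lemma field_rep_has_derivative:
  assumes "smooth_field A X" "c \<in> charts_at A p"
  shows "(field_rep c X has_derivative fderiv (field_rep c X) (snd c p)) (at (snd c p))"
  using assms smooth_on_has_derivative[of "snd c ` fst c"]
  unfolding smooth_field_def charts_at_iff by blast

lemma field_rep_bracket:
  assumes "c \<in> A" "x \<in> snd c ` fst c"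
  shows "field_rep c (field_bracket A X Y) x =
    fderiv (field_rep c Y) x (field_rep c X x) - fderiv (field_rep c X) x (field_rep c Y x)"
  using assms chart_inv_in[OF assms] snd_chart_inv[OF assms]
  by (simp add: field_rep_def field_bracket_def charts_at_iff)

end

lemma related_coord:
  assumes A: "smooth_manifold A" and B: "smooth_manifold B" and f: "smooth_map A B f"
    and X: "smooth_field A X" and rel: "field_related A B f X Y"
    and c: "c \<in> A" and d: "d \<in> B" and x: "x \<in> coord_dom c d f"
  shows "fderiv (coord_map c d f) x (field_rep c X x) = field_rep d Y (coord_map c d f x)"
proof -
  obtain p where p: "p \<in> fst c" "f p \<in> fst d" "x = snd c p" using x by auto
  have c': "c \<in> charts_at A p" and d': "d \<in> charts_at B (f p)"
    using p c d by (auto simp: charts_at_iff)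
  have "X p \<in> tangent_space A p" using X unfolding smooth_field_def by blast
  from differential_component[OF A B f this c' d']
  have "Y (f p) d = fderiv (coord_map c d f) x (X p c)"
    using rel p(3) unfolding field_related_def by simp
  moreover have "coord_map c d f x = snd d (f p)"
    using smooth_manifold.chart_inv_snd[OF A c p(1)] p(3) by (simp add: coord_map_def)
  ultimately show ?thesis
    using smooth_manifold.field_rep_snd[OF A c'] smooth_manifold.field_rep_snd[OF B d'] p(3) by simp
qed

text \<open>The derivative of the relation \<open>df(X) = Y \<circ> f\<close> in coordinates.\<close>

lemma related_fderiv:
  assumes A: "smooth_manifold A" and B: "smooth_manifold B" and f: "smooth_map A B f"
    and X: "smooth_field A X" and Y: "smooth_field B Y" and rel: "field_related A B f X Y"
    and c: "c \<in> charts_at A p" and d: "d \<in> charts_at B (f p)"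
  defines "F \<equiv> coord_map c d f" and "x \<equiv> snd c p"
  shows "fderiv (\<lambda>y. fderiv F y (X p c)) x v + fderiv F x (fderiv (field_rep c X) x v)
    = fderiv (field_rep d Y) (snd d (f p)) (fderiv F x v)"
proof -
  have c': "c \<in> A" "p \<in> fst c" and d': "d \<in> B" "f p \<in> fst d"
    using c d by (auto simp: charts_at_iff)
  have op: "open (coord_dom c d f)" by (rule open_coord_dom[OF A B f c'(1) d'(1)])
  have sm: "smooth_on (coord_dom c d f) F"
    unfolding F_def by (rule smooth_on_coord_map[OF f c'(1) d'(1)])
  have x: "x \<in> coord_dom c d f" using c' d' unfolding x_def by auto
  have Fx: "F x = snd d (f p)"
    using smooth_manifold.chart_inv_snd[OF A c'] by (simp add: F_def x_def coord_map_def)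
  \<comment> \<open>One map is differentiated in two ways: by the product rule as
    \<open>fderiv F y (field_rep c X y)\<close>, and by the chain rule as
    \<open>field_rep d Y (F y)\<close>.\<close>
  have "((\<lambda>y. fderiv F y (field_rep c X y)) has_derivative
      (\<lambda>v. fderiv (\<lambda>y. fderiv F y (field_rep c X x)) x v + fderiv F x (fderiv (field_rep c X) x v))) (at x)"
  proof (rule has_derivative_linear_family[OF smooth_manifold.finite_dim[OF A] op x])
    show "linear (fderiv F y)" if "y \<in> coord_dom c d f" for y
      using linear_smooth_fderiv[OF sm that] .
    show "(\<lambda>y. fderiv F y b) differentiable (at x)" for b
      using smooth_on_differentiable[OF smooth_on_fderiv[OF sm] x] .
    show "(field_rep c X has_derivative fderiv (field_rep c X) x) (at x)"
      unfolding x_def by (rule smooth_manifold.field_rep_has_derivative[OF A X c])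
  qed
  then have "((\<lambda>y. field_rep d Y (F y)) has_derivative
      (\<lambda>v. fderiv (\<lambda>y. fderiv F y (field_rep c X x)) x v + fderiv F x (fderiv (field_rep c X) x v))) (at x)"
    by (rule has_derivative_transform_within_open[OF _ op x])
       (use related_coord[OF A B f X rel c'(1) d'(1)] F_def in simp)
  moreover have "((\<lambda>y. field_rep d Y (F y)) has_derivative
      (\<lambda>v. fderiv (field_rep d Y) (snd d (f p)) (fderiv F x v))) (at x)"
    using diff_chain_at[OF smooth_on_has_derivative[OF sm x], of "field_rep d Y"]
      smooth_manifold.field_rep_has_derivative[OF B Y d]
    unfolding Fx[symmetric] by (simp add: o_def)
  ultimately have "(\<lambda>v. fderiv (\<lambda>y. fderiv F y (field_rep c X x)) x v + fderiv F x (fderiv (field_rep c X) x v))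
      = (\<lambda>v. fderiv (field_rep d Y) (snd d (f p)) (fderiv F x v))"
    by (rule has_derivative_unique)
  from fun_cong[OF this, of v] show ?thesis
    using smooth_manifold.field_rep_snd[OF A c, of X] unfolding x_def by simp
qed

text \<open>Differentiate the second relation along \<open>X1\<close> and the first along
  \<open>X2\<close>, then subtract: the second derivatives of the local representative cancel by
  symmetry, and the rest is the bracket on either side.\<close>

lemma related_bracket_coord:
  assumes A: "smooth_manifold A" and B: "smooth_manifold B" and f: "smooth_map A B f"
    and X1: "smooth_field A X1" and Y1: "smooth_field B Y1" and r1: "field_related A B f X1 Y1"
    and X2: "smooth_field A X2" and Y2: "smooth_field B Y2" and r2: "field_related A B f X2 Y2"
    and c: "c \<in> charts_at A p" and d: "d \<in> charts_at B (f p)"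
  shows "fderiv (coord_map c d f) (snd c p) (field_bracket A X1 X2 p c) = field_bracket B Y1 Y2 (f p) d"
proof -
  define F where "F = coord_map c d f"
  define x where "x = snd c p"
  have c': "c \<in> A" "p \<in> fst c" and d': "d \<in> B" "f p \<in> fst d"
    using c d by (auto simp: charts_at_iff)
  have op: "open (coord_dom c d f)" by (rule open_coord_dom[OF A B f c'(1) d'(1)])
  have sm: "smooth_on (coord_dom c d f) F"
    unfolding F_def by (rule smooth_on_coord_map[OF f c'(1) d'(1)])
  have x: "x \<in> coord_dom c d f" using c' d' unfolding x_def by auto
  have lin: "linear (fderiv F x)" using linear_smooth_fderiv[OF sm x] .
  have Fx: "F x = snd d (f p)"
    using smooth_manifold.chart_inv_snd[OF A c'] by (simp add: F_def x_def coord_map_def)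
  have Y: "fderiv F x (X p c) = Y (f p) d" if "smooth_field A X" "field_related A B f X Y" for X Y
    using related_coord[OF A B f that c'(1) d'(1) x] Fx
      smooth_manifold.field_rep_snd[OF A c] smooth_manifold.field_rep_snd[OF B d]
    by (simp add: F_def x_def)
  have "fderiv (\<lambda>y. fderiv F y (X2 p c)) x (X1 p c) = fderiv (\<lambda>y. fderiv F y (X1 p c)) x (X2 p c)"
    by (rule fderiv_commute[OF op x sm])
  moreover have "fderiv (\<lambda>y. fderiv F y (X2 p c)) x (X1 p c) + fderiv F x (fderiv (field_rep c X2) x (X1 p c))
      = fderiv (field_rep d Y2) (snd d (f p)) (Y1 (f p) d)"
    using related_fderiv[OF A B f X2 Y2 r2 c d, of "X1 p c"] Y[OF X1 r1] by (simp add: F_def x_def)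
  moreover have "fderiv (\<lambda>y. fderiv F y (X1 p c)) x (X2 p c) + fderiv F x (fderiv (field_rep c X1) x (X2 p c))
      = fderiv (field_rep d Y1) (snd d (f p)) (Y2 (f p) d)"
    using related_fderiv[OF A B f X1 Y1 r1 c d, of "X2 p c"] Y[OF X2 r2] by (simp add: F_def x_def)
  ultimately have "fderiv F x (fderiv (field_rep c X2) x (X1 p c)) - fderiv F x (fderiv (field_rep c X1) x (X2 p c))
      = fderiv (field_rep d Y2) (snd d (f p)) (Y1 (f p) d) - fderiv (field_rep d Y1) (snd d (f p)) (Y2 (f p) d)"
    by (metis add_diff_cancel_left)
  then show ?thesis
    using c d by (simp add: field_bracket_def F_def[symmetric] x_def[symmetric] linear_diff[OF lin])
qed

text \<open>Every field is related to itself by the identity, whose local representatives are the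
  transition maps; naturality of the bracket then says that its components transform as a tangent
  vector.\<close>

lemma (in smooth_manifold) field_bracket_in:
  assumes X: "smooth_field A X" and Y: "smooth_field A Y"
  shows "field_bracket A X Y p \<in> tangent_space A p"
proof -
  have rel: "field_related A A (\<lambda>q. q) Z Z" if "smooth_field A Z" for Z
    using that differential_id unfolding field_related_def smooth_field_def by blast
  show ?thesis
    unfolding tangent_space_def
    using related_bracket_coord[OF smooth_manifold_axioms smooth_manifold_axioms smooth_map_id
        X X rel[OF X] Y Y rel[OF Y]]
    by (auto simp: field_bracket_def)
qed

lemma related_bracket:
  assumes A: "smooth_manifold A" and B: "smooth_manifold B" and f: "smooth_map A B f"
    and X1: "smooth_field A X1" and Y1: "smooth_field B Y1" and r1: "field_related A B f X1 Y1"
    and X2: "smooth_field A X2" and Y2: "smooth_field B Y2" and r2: "field_related A B f X2 Y2"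
  shows "field_related A B f (field_bracket A X1 X2) (field_bracket B Y1 Y2)"
  unfolding field_related_def
proof
  fix p
  have c: "chart_at A p \<in> charts_at A p" by (rule smooth_manifold.chart_at[OF A])
  have d: "chart_at B (f p) \<in> charts_at B (f p)" by (rule smooth_manifold.chart_at[OF B])
  note br = smooth_manifold.field_bracket_in[OF A X1 X2, of p]
  show "differential A B f p (field_bracket A X1 X2 p) = field_bracket B Y1 Y2 (f p)"
    using differential_component[OF A B f br c d] related_bracket_coord[OF A B f X1 Y1 r1 X2 Y2 r2 c d]
    by (intro tangent_eqI[OF differential_in[OF A B f br] smooth_manifold.field_bracket_in[OF B Y1 Y2] d])
      simp
qed

section \<open>Left invariant fields\<close>

context smooth_manifold
begin

lemma chart_inv_prod:
  assumes "c \<in> A" "d \<in> A" "p \<in> fst c" "q \<in> fst d"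
  shows "chart_inv (fst c \<times> fst d, map_prod (snd c) (snd d)) (snd c p, snd d q) = (p, q)"
proof -
  have "inj_on (map_prod (snd c) (snd d)) (fst c \<times> fst d)"
    using chart_inv_snd[OF assms(1)] chart_inv_snd[OF assms(2)]
    by (intro inj_on_inverseI[of _ "map_prod (chart_inv c) (chart_inv d)"]) auto
  from inv_into_f_eq[OF this, of "(p, q)" "(snd c p, snd d q)"] show ?thesis
    using assms by (simp add: chart_inv_def)
qed

end

context lie_group
begin

section \<open>Multiplication in coordinates and left translations\<close>

lemma smooth_manifold: "smooth_manifold A" by unfold_locales

text \<open>The factors have separate charts \<open>c\<close> and \<open>c'\<close>, as in
  \<open>prod_atlas\<close>, and \<open>d\<close> is the chart for the product; the slices keep one
  factor fixed.\<close>

definition mul_rep :: "('g, 'e) chart \<Rightarrow> ('g, 'e) chart \<Rightarrow> ('g, 'e) chart \<Rightarrow> 'e \<times> 'e \<Rightarrow> 'e"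
  where "mul_rep c c' d =
    coord_map (fst c \<times> fst c', map_prod (snd c) (snd c')) d (\<lambda>(a, b). mul a b)"

definition mul_dom :: "('g, 'e) chart \<Rightarrow> ('g, 'e) chart \<Rightarrow> ('g, 'e) chart \<Rightarrow> ('e \<times> 'e) set"
  where "mul_dom c c' d = {(snd c p, snd c' q) | p q. p \<in> fst c \<and> q \<in> fst c' \<and> mul p q \<in> fst d}"

lemma continuous_mul: "continuous_on UNIV (\<lambda>(a, b). mul a b)"
  using smooth_mult unfolding smooth_map_def by blast

lemma continuous_left_mul: "continuous_on UNIV (mul a)"
proof -
  have "continuous_on UNIV (\<lambda>b. (\<lambda>(a, b). mul a b) (a, b))"
    by (rule continuous_on_compose2[OF continuous_mul]) (auto intro!: continuous_intros)
  then show ?thesis by (simp add: eta_contract_eq)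
qed

lemma mul_rep_apply:
  assumes "c \<in> A" "c' \<in> A" "p \<in> fst c" "q \<in> fst c'"
  shows "mul_rep c c' d (snd c p, snd c' q) = snd d (mul p q)"
  using chart_inv_prod[OF assms] by (simp add: mul_rep_def coord_map_def)

lemma smooth_mul_rep:
  assumes "c \<in> A" "c' \<in> A" "d \<in> A"
  shows "smooth_on (mul_dom c c' d) (mul_rep c c' d)"
proof -
  have "mul_dom c c' d = coord_dom (fst c \<times> fst c', map_prod (snd c) (snd c')) d (\<lambda>(a, b). mul a b)"
    unfolding mul_dom_def by force
  moreover have "(fst c \<times> fst c', map_prod (snd c) (snd c')) \<in> prod_atlas A A"
    using assms unfolding prod_atlas_def by blast
  ultimately show ?thesis
    using smooth_mult assms(3) unfolding smooth_map_def mul_rep_def by metis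
qed

lemma open_mul_dom:
  assumes "c \<in> A" "c' \<in> A" "d \<in> A"
  shows "open (mul_dom c c' d)"
proof -
  let ?S = "(snd c ` fst c) \<times> (snd c' ` fst c')"
  let ?h = "\<lambda>z. (\<lambda>(a, b). mul a b) (chart_inv c (fst z), chart_inv c' (snd z))"
  have ci: "continuous_on (snd e ` fst e) (chart_inv e)" if "e \<in> A" for e
    using chart_homeo[OF that] unfolding homeomorphism_def by blast
  have "continuous_on ?S ?h"
  proof (rule continuous_on_compose2[OF continuous_mul])
    show "continuous_on ?S (\<lambda>z. (chart_inv c (fst z), chart_inv c' (snd z)))"
      by (intro continuous_on_Pair continuous_on_compose2[OF ci[OF assms(1)]]
          continuous_on_compose2[OF ci[OF assms(2)]] continuous_intros) auto
  qed simp
  moreover have "open ?S" using assms open_chart_image by (intro open_Times)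
  moreover have "open (fst d)" using charts[OF assms(3)] unfolding is_chart_def by blast
  ultimately have "open (?S \<inter> ?h -` fst d)" by (rule continuous_open_preimage)
  moreover have "?S \<inter> ?h -` fst d = mul_dom c c' d"
  proof -
    have "(snd c p, snd c' q) \<in> mul_dom c c' d \<longleftrightarrow> mul p q \<in> fst d" if "p \<in> fst c" "q \<in> fst c'" for p q
      using that chart_inv_snd[OF assms(1)] chart_inv_snd[OF assms(2)]
      unfolding mul_dom_def by clarsimp metis
    then show ?thesis
      using chart_inv_snd[OF assms(1)] chart_inv_snd[OF assms(2)]
      unfolding mul_dom_def by auto
  qed
  ultimately show ?thesis by simp
qed

text \<open>In a chart \<open>e\<close> around \<open>a\<close>, translation by \<open>a\<close> is
  multiplication with its first coordinate frozen at \<open>snd e a\<close>.\<close>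

lemma smooth_left_mul: "smooth_map A A (mul a)"
  unfolding smooth_map_def
proof (intro conjI ballI continuous_left_mul)
  fix c d assume c: "c \<in> A" and d: "d \<in> A"
  define e where "e = chart_at A a"
  have e: "e \<in> A" "a \<in> fst e" using chart_at[of a] by (auto simp: e_def charts_at_iff)
  have "open (mul a -` fst d)"
    using continuous_left_mul charts[OF d] open_vimage unfolding is_chart_def by blast
  then have op: "open (coord_dom c d (mul a))" by (rule open_image_chart[OF c])
  have "smooth_on {y. (snd e a, y) \<in> mul_dom e c d} (\<lambda>y. mul_rep e c d (snd e a, y))"
    by (intro smooth_on_Pair_right open_mul_dom smooth_mul_rep e c d)
  moreover have "coord_dom c d (mul a) \<subseteq> {y. (snd e a, y) \<in> mul_dom e c d}"
    using e unfolding mul_dom_def by auto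
  ultimately have "smooth_on (coord_dom c d (mul a)) (\<lambda>y. mul_rep e c d (snd e a, y))"
    by (rule smooth_on_subset)
  then show "smooth_on (coord_dom c d (mul a)) (coord_map c d (mul a))"
    by (rule smooth_on_cong[OF op, rotated])
       (use e chart_inv_snd[OF c] mul_rep_apply[OF e(1) c, where d = d] in \<open>auto simp: coord_map_def\<close>)
qed

section \<open>Left invariant fields of Lie algebra elements\<close>

abbreviation \<open>LF \<equiv> left_invariant_field mul one A\<close>
abbreviation \<open>\<LL> \<equiv> lie_algebra one A\<close>
abbreviation \<open>br \<equiv> lie_bracket mul one A\<close>

lemma left_field_in: "u \<in> \<LL> \<Longrightarrow> LF u a \<in> tangent_space A a"
  using differential_in[OF smooth_manifold smooth_manifold smooth_left_mul, of u one a]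
  by (simp add: left_invariant_field_def lie_algebra_def)

lemma linear_left_field: "linear (\<lambda>u. LF u a)"
  unfolding left_invariant_field_def
  by (rule linear_differential[OF smooth_manifold smooth_left_mul])

lemma left_field_one: "u \<in> \<LL> \<Longrightarrow> LF u one = u"
proof -
  have "mul one = (\<lambda>q. q)" by (rule ext) simp
  then show "u \<in> \<LL> \<Longrightarrow> LF u one = u"
    using differential_id by (simp add: left_invariant_field_def lie_algebra_def)
qed

lemma left_field_related:
  assumes u: "u \<in> \<LL>"
  shows "field_related A A (mul a) (LF u) (LF u)"
  unfolding field_related_def
proof
  fix b
  have "mul (mul a b) = (\<lambda>q. mul a (mul b q))" by (rule ext) (rule assoc)
  then show "differential A A (mul a) b (LF u b) = LF u (mul a b)"
    using differential_chain[OF smooth_manifold smooth_manifold smooth_manifold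
        smooth_left_mul smooth_left_mul, of u one a b] u
    by (simp add: left_invariant_field_def lie_algebra_def)
qed

text \<open>Translation by \<open>inverse a\<close> brings \<open>v\<close> to the identity. With
  \<open>left_field_inj\<close>, evaluation at \<open>a\<close> identifies the Lie algebra with the
  tangent space at \<open>a\<close>, so left invariant fields suffice as test fields.\<close>

lemma left_field_surj:
  assumes v: "v \<in> tangent_space A a"
  obtains u where "u \<in> \<LL>" "LF u a = v"
proof
  let ?u = "differential A A (mul (inverse a)) a v"
  show "?u \<in> \<LL>"
    using differential_in[OF smooth_manifold smooth_manifold smooth_left_mul v, of "inverse a"]
    by (simp add: lie_algebra_def)
  have "(\<lambda>q. mul a (mul (inverse a) q)) = (\<lambda>q. q)" by (rule ext) (simp add: assoc[symmetric])
  then show "LF ?u a = v"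
    using differential_chain[OF smooth_manifold smooth_manifold smooth_manifold
        smooth_left_mul smooth_left_mul v, of a "inverse a"] differential_id[OF v]
    by (simp add: left_invariant_field_def)
qed

lemma left_field_inj:
  assumes u: "u \<in> \<LL>" and v: "v \<in> \<LL>" and eq: "LF u a = LF v a"
  shows "u = v"
proof -
  have "LF w one = differential A A (mul (inverse a)) a (LF w a)" if "w \<in> \<LL>" for w
    using left_field_related[OF that, of "inverse a"] unfolding field_related_def by simp
  then show ?thesis using left_field_one u v eq by metis
qed

text \<open>In coordinates the field is the partial derivative of multiplication in its second
  variable, at the identity and in direction \<open>u e\<close>, as a function of the first
  variable.\<close>

lemma smooth_left_field:
  assumes u: "u \<in> \<LL>"
  shows "smooth_field A (LF u)"
  unfolding smooth_field_def
proof (intro conjI allI ballI left_field_in u)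
  fix c assume c: "c \<in> A"
  define e where "e = chart_at A one"
  have e: "e \<in> charts_at A one" unfolding e_def by (rule chart_at)
  then have e': "e \<in> A" "one \<in> fst e" by (auto simp: charts_at_iff)
  let ?y = "snd e one"
  have sub: "snd c ` fst c \<subseteq> {x. (x, ?y) \<in> mul_dom c e c}"
  proof
    fix x assume "x \<in> snd c ` fst c"
    then obtain p where "p \<in> fst c" "x = snd c p" by auto
    then show "x \<in> {x. (x, ?y) \<in> mul_dom c e c}"
      using e' unfolding mul_dom_def
      by (intro CollectI exI[of _ p] exI[of _ one]) simp
  qed
  have "smooth_on {x. (x, ?y) \<in> mul_dom c e c} (\<lambda>x. fderiv (mul_rep c e c) (x, ?y) (0, u e))"
    by (rule smooth_on_Pair_left[OF open_mul_dom smooth_on_fderiv[OF smooth_mul_rep]]) (use c e' in auto)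
  then have "smooth_on (snd c ` fst c) (\<lambda>x. fderiv (mul_rep c e c) (x, ?y) (0, u e))"
    using sub by (rule smooth_on_subset)
  then show "smooth_on (snd c ` fst c) (field_rep c (LF u))"
  proof (rule smooth_on_cong[OF open_chart_image[OF c], rotated])
    fix x assume "x \<in> snd c ` fst c"
    then obtain p where p: "p \<in> fst c" "x = snd c p" by auto
    then have cp: "c \<in> charts_at A p" using c by (simp add: charts_at_iff)
    have "((\<lambda>y. mul_rep c e c (x, y)) has_derivative (\<lambda>v. fderiv (mul_rep c e c) (x, ?y) (0, v))) (at ?y)"
      using sub p c e'
      by (intro has_derivative_Pair_right smooth_on_has_derivative[OF smooth_mul_rep]) auto
    then have "fderiv (mul_rep c e c) (x, ?y) (0, u e) = fderiv (\<lambda>y. mul_rep c e c (x, y)) ?y (u e)"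
      by (simp add: fderiv_eqI)
    also have "fderiv (\<lambda>y. mul_rep c e c (x, y)) ?y = fderiv (coord_map e c (mul p)) ?y"
    proof (rule fderiv_cong_open[OF open_coord_dom[OF smooth_manifold smooth_manifold
            smooth_left_mul e'(1) c, of p]])
      show "?y \<in> coord_dom e c (mul p)" using e' p by auto
      show "\<And>y. y \<in> coord_dom e c (mul p) \<Longrightarrow> mul_rep c e c (x, y) = coord_map e c (mul p) y"
        using mul_rep_apply[OF c e'(1) p(1), where d = c] p(2) chart_inv_snd[OF e'(1)]
        by (auto simp: coord_map_def)
    qed
    also have "fderiv (coord_map e c (mul p)) ?y (u e) = LF u p c"
      using differential_component[OF smooth_manifold smooth_manifold smooth_left_mul _ e, of u c p]
        u cp by (simp add: left_invariant_field_def lie_algebra_def)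
    also have "\<dots> = field_rep c (LF u) x" using field_rep_snd[OF cp] p by simp
    finally show "fderiv (mul_rep c e c) (x, ?y) (0, u e) = field_rep c (LF u) x" .
  qed
qed

section \<open>The bracket on the Lie algebra\<close>

lemma bracket_in: "u \<in> \<LL> \<Longrightarrow> v \<in> \<LL> \<Longrightarrow> br u v \<in> \<LL>"
  unfolding lie_bracket_def using field_bracket_in smooth_left_field by (simp add: lie_algebra_def)

text \<open>Left translations relate left invariant fields to themselves, hence also their bracket,
  which is therefore determined by its value at the identity.\<close>

lemma left_field_bracket:
  assumes u: "u \<in> \<LL>" and v: "v \<in> \<LL>"
  shows "field_bracket A (LF u) (LF v) = LF (br u v)"
proof
  fix a
  have "field_related A A (mul a) (field_bracket A (LF u) (LF v)) (field_bracket A (LF u) (LF v))"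
    using u v smooth_left_field left_field_related
    by (intro related_bracket smooth_manifold smooth_left_mul)
  then have "differential A A (mul a) one (field_bracket A (LF u) (LF v) one)
      = field_bracket A (LF u) (LF v) (mul a one)"
    unfolding field_related_def by blast
  then show "field_bracket A (LF u) (LF v) a = LF (br u v) a"
    by (simp add: left_invariant_field_def lie_bracket_def)
qed

lemma bracket_component:
  assumes "u \<in> \<LL>" "v \<in> \<LL>" "c \<in> charts_at A one"
  shows "br u v c = fderiv (field_rep c (LF v)) (snd c one) (u c)
    - fderiv (field_rep c (LF u)) (snd c one) (v c)"
  using assms by (simp add: lie_bracket_def field_bracket_def left_field_one)

text \<open>The product rule for the coordinate bracket
  \<open>fderiv V y (U y) - fderiv U y (V y)\<close>; it enters when iterated brackets are expanded
  for the Jacobi identity.\<close>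

lemma fderiv_left_field_bracket:
  assumes u: "u \<in> \<LL>" and v: "v \<in> \<LL>" and c: "c \<in> charts_at A one"
  defines "U \<equiv> field_rep c (LF u)" and "V \<equiv> field_rep c (LF v)" and "x \<equiv> snd c one"
  shows "fderiv (field_rep c (LF (br u v))) x w =
    (fderiv (\<lambda>y. fderiv V y (u c)) x w + fderiv V x (fderiv U x w))
    - (fderiv (\<lambda>y. fderiv U y (v c)) x w + fderiv U x (fderiv V x w))"
proof -
  have c': "c \<in> A" "one \<in> fst c" using c by (auto simp: charts_at_iff)
  have S: "open (snd c ` fst c)" "x \<in> snd c ` fst c"
    using open_chart_image c' by (auto simp: x_def)
  have sm: "smooth_on (snd c ` fst c) (field_rep c (LF z))" if "z \<in> \<LL>" for z
    using smooth_left_field[OF that] c' unfolding smooth_field_def by blast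
  have val: "field_rep c (LF z) x = z c" if "z \<in> \<LL>" for z
    using field_rep_snd[OF c] left_field_one[OF that] by (simp add: x_def)
  have D: "((\<lambda>y. fderiv (field_rep c (LF z)) y (field_rep c (LF t) y)) has_derivative
      (\<lambda>w. fderiv (\<lambda>y. fderiv (field_rep c (LF z)) y (t c)) x w
        + fderiv (field_rep c (LF z)) x (fderiv (field_rep c (LF t)) x w))) (at x)"
    if "z \<in> \<LL>" "t \<in> \<LL>" for z t
    unfolding val[OF that(2), symmetric]
  proof (rule has_derivative_linear_family[OF finite_dim S])
    show "linear (fderiv (field_rep c (LF z)) y)" if "y \<in> snd c ` fst c" for y
      using linear_smooth_fderiv[OF sm[OF \<open>z \<in> \<LL>\<close>] that] .
    show "(\<lambda>y. fderiv (field_rep c (LF z)) y b) differentiable (at x)" for b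
      using smooth_on_differentiable[OF smooth_on_fderiv[OF sm[OF \<open>z \<in> \<LL>\<close>]] S(2)] .
    show "(field_rep c (LF t) has_derivative fderiv (field_rep c (LF t)) x) (at x)"
      using smooth_on_has_derivative[OF sm[OF \<open>t \<in> \<LL>\<close>] S(2)] .
  qed
  have "((\<lambda>y. fderiv V y (U y) - fderiv U y (V y)) has_derivative
      (\<lambda>w. (fderiv (\<lambda>y. fderiv V y (u c)) x w + fderiv V x (fderiv U x w))
      - (fderiv (\<lambda>y. fderiv U y (v c)) x w + fderiv U x (fderiv V x w)))) (at x)"
    unfolding U_def V_def by (intro has_derivative_diff D u v)
  then have "(field_rep c (LF (br u v)) has_derivative
      (\<lambda>w. (fderiv (\<lambda>y. fderiv V y (u c)) x w + fderiv V x (fderiv U x w))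
      - (fderiv (\<lambda>y. fderiv U y (v c)) x w + fderiv U x (fderiv V x w)))) (at x)"
  proof (rule has_derivative_transform_within_open[OF _ S])
    fix y assume "y \<in> snd c ` fst c"
    from field_rep_bracket[OF c'(1) this, of "LF u" "LF v"]
    show "fderiv V y (U y) - fderiv U y (V y) = field_rep c (LF (br u v)) y"
      unfolding left_field_bracket[OF u v] U_def V_def by simp
  qed
  from fderiv_eqI[OF this] show ?thesis by simp
qed

lemma lie_algebra: "lie_algebra_on \<LL> br"
proof
  define c where "c = chart_at A one"
  define x where "x = snd c one"
  have c: "c \<in> charts_at A one" unfolding c_def by (rule chart_at)
  then have c': "c \<in> A" "one \<in> fst c" by (auto simp: charts_at_iff)
  have S: "open (snd c ` fst c)" "x \<in> snd c ` fst c"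
    using open_chart_image c' by (auto simp: x_def)
  define R where "R = (\<lambda>u. field_rep c (LF u))"
  have sm: "smooth_on (snd c ` fst c) (R z)" if "z \<in> \<LL>" for z
    using smooth_left_field[OF that] c' unfolding smooth_field_def R_def by blast
  have dR: "(R z has_derivative fderiv (R z) x) (at x)" if "z \<in> \<LL>" for z
    using smooth_on_has_derivative[OF sm[OF that] S(2)] .
  have linD: "linear (fderiv (R z) x)" if "z \<in> \<LL>" for z
    using linear_smooth_fderiv[OF sm[OF that] S(2)] .
  have comp: "br u v c = fderiv (R v) x (u c) - fderiv (R u) x (v c)" if "u \<in> \<LL>" "v \<in> \<LL>" for u v
    unfolding R_def x_def using that c by (rule bracket_component)
  have eqI: "u = v" if "u \<in> \<LL>" "v \<in> \<LL>" "u c = v c" for u v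
    using tangent_eqI[OF _ _ c] that unfolding lie_algebra_def by blast
  show sub: "subspace \<LL>" unfolding lie_algebra_def by (rule subspace_tangent_space)
  show "br u v \<in> \<LL>" if "u \<in> \<LL>" "v \<in> \<LL>" for u v using that by (rule bracket_in)
  show "br (u + v) w = br u w + br v w" if L: "u \<in> \<LL>" "v \<in> \<LL>" "w \<in> \<LL>" for u v w
  proof (rule eqI)
    have uv: "u + v \<in> \<LL>" using L subspace_add[OF sub] by simp
    have "R (u + v) = (\<lambda>y. R u y + R v y)"
      by (simp add: R_def field_rep_def linear_add[OF linear_left_field] fun_eq_iff)
    then have "fderiv (R (u + v)) x = (\<lambda>y. fderiv (R u) x y + fderiv (R v) x y)"
      using has_derivative_add[OF dR[OF L(1)] dR[OF L(2)]] by (simp add: fderiv_eqI)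
    then show "br (u + v) w c = (br u w + br v w) c"
      using comp[OF uv L(3)] comp[OF L(1,3)] comp[OF L(2,3)] linear_add[OF linD[OF L(3)]] by simp
  qed (use L bracket_in subspace_add[OF sub] in simp_all)
  show "br (r *\<^sub>R u) v = r *\<^sub>R br u v" if L: "u \<in> \<LL>" "v \<in> \<LL>" for u v r
  proof (rule eqI)
    have uv: "r *\<^sub>R u \<in> \<LL>" using L subspace_scale[OF sub] by simp
    have "R (r *\<^sub>R u) = (\<lambda>y. r *\<^sub>R R u y)"
      by (simp add: R_def field_rep_def linear_scale[OF linear_left_field] fun_eq_iff)
         (simp add: scaleR_fun_def)
    then have "fderiv (R (r *\<^sub>R u)) x = (\<lambda>y. r *\<^sub>R fderiv (R u) x y)"
      using has_derivative_scaleR_right[OF dR[OF L(1)]] by (simp add: fderiv_eqI)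
    then show "br (r *\<^sub>R u) v c = (r *\<^sub>R br u v) c"
      using comp[OF uv L(2)] comp[OF L] linear_scale[OF linD[OF L(2)]]
      by (simp add: scaleR_fun_def scaleR_diff_right)
  qed (use L bracket_in subspace_scale[OF sub] in simp_all)
  show anti: "br u v = - br v u" if L: "u \<in> \<LL>" "v \<in> \<LL>" for u v
    by (rule eqI) (use L bracket_in subspace_neg[OF sub] comp in simp_all)
  show "br u (br v w) = br (br u v) w + br v (br u w)" if L: "u \<in> \<LL>" "v \<in> \<LL>" "w \<in> \<LL>" for u v w
  proof (rule eqI)
    have Q: "br a (br b d) c = (fderiv (\<lambda>y. fderiv (R d) y (b c)) x (a c) + fderiv (R d) x (fderiv (R b) x (a c)))
      - (fderiv (\<lambda>y. fderiv (R b) y (d c)) x (a c) + fderiv (R b) x (fderiv (R d) x (a c)))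
      - (fderiv (R a) x (fderiv (R d) x (b c)) - fderiv (R a) x (fderiv (R b) x (d c)))"
      if "a \<in> \<LL>" "b \<in> \<LL>" "d \<in> \<LL>" for a b d
      using comp[OF that(1) bracket_in[OF that(2,3)]] comp[OF that(2,3)] linear_diff[OF linD[OF that(1)]]
        fderiv_left_field_bracket[OF that(2,3) c, of "a c"]
      by (simp add: R_def x_def)
    have sym: "fderiv (\<lambda>y. fderiv (R z) y s) x t = fderiv (\<lambda>y. fderiv (R z) y t) x s" if "z \<in> \<LL>" for z s t
      by (rule fderiv_commute[OF S sm[OF that]])
    \<comment> \<open>With this bracket turned round, \<open>Q\<close> expands all three terms. The
      terms with two first derivatives cancel, and those with a second derivative cancel in pairs by
      \<open>sym\<close>.\<close>
    have "br (br u v) w c = - br w (br u v) c"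
      using anti[OF bracket_in[OF L(1,2)] L(3)] by simp
    then show "br u (br v w) c = (br (br u v) w + br v (br u w)) c"
      using Q[OF L(1,2,3)] Q[OF L(3,1,2)] Q[OF L(2,1,3)]
        sym[OF L(1), of "v c" "w c"] sym[OF L(2), of "u c" "w c"] sym[OF L(3), of "u c" "v c"]
      by simp
  qed (use L bracket_in subspace_add[OF sub] in simp_all)
qed

end

section \<open>The Levi-Civita connection on fields of constant length\<close>

context riemannian_manifold
begin

lemma inner_product_on_tangent: "inner_product_on (tangent_space A p) (g p)"
  using tangent_space_finite_span metric_add metric_scale metric_sym metric_pos
  by unfold_locales

lemma orthonormal_basis_iff:
  "orthonormal_basis A g p E \<longleftrightarrow> inner_product_on.orthonormal (tangent_space A p) (g p) E"
  unfolding orthonormal_basis_def inner_product_on.orthonormal_def[OF inner_product_on_tangent] ..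

lemma local_metric_coord:
  assumes c: "c \<in> charts_at A p"
  shows "local_metric A g c (snd c p) u v = g p (coord_vector A c p u) (coord_vector A c p v)"
  using c by (simp add: local_metric_def charts_at_iff chart_inv_snd)

lemma local_metric_component:
  assumes "c \<in> charts_at A p" "v \<in> tangent_space A p" "w \<in> tangent_space A p"
  shows "local_metric A g c (snd c p) (v c) (w c) = g p v w"
  using assms by (simp add: local_metric_coord coord_vector_eq)

text \<open>This is the pullback of the metric along \<open>coord_vector\<close>, which is linear
  and injective because the component in \<open>c\<close> recovers its argument.\<close>

lemma inner_product_on_local_metric:
  assumes c: "c \<in> A" and x: "x \<in> snd c ` fst c"
  shows "inner_product_on UNIV (local_metric A g c x)"
proof -
  obtain p where p: "x = snd c p" "c \<in> charts_at A p" using c x by (auto simp: charts_at_iff)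
  note lin = linear_coord_vector[OF p(2)] and inT = coord_vector_in[OF p(2)]
  note G = local_metric_coord[OF p(2)]
  show ?thesis
    unfolding p(1)
  proof
    show "\<exists>T::'e set. finite T \<and> T \<subseteq> UNIV \<and> span T = UNIV" using finite_dim by simp
    show "local_metric A g c (snd c p) (u + v) w
        = local_metric A g c (snd c p) u w + local_metric A g c (snd c p) v w" for u v w
      unfolding G linear_add[OF lin] by (intro metric_add inT)
    show "local_metric A g c (snd c p) (r *\<^sub>R u) w = r * local_metric A g c (snd c p) u w" for r u w
      unfolding G linear_scale[OF lin] by (intro metric_scale inT)
    show "local_metric A g c (snd c p) u v = local_metric A g c (snd c p) v u" for u v
      unfolding G by (intro metric_sym inT)
    show "local_metric A g c (snd c p) u u > 0" if "u \<noteq> 0" for u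
    proof -
      have "coord_vector A c p u c \<noteq> 0" using that coord_vector_same[OF p(2)] by simp
      then have "coord_vector A c p u \<noteq> 0" by (metis zero_fun_apply)
      then show ?thesis unfolding G by (intro metric_pos inT)
    qed
  qed
qed

lemma linear_local_metric:
  assumes "c \<in> A" "x \<in> snd c ` fst c"
  shows "linear (local_metric A g c x u)" "linear (\<lambda>u. local_metric A g c x u v)"
proof -
  interpret inner_product_on UNIV "local_metric A g c x"
    by (rule inner_product_on_local_metric[OF assms])
  show "linear (\<lambda>u. local_metric A g c x u v)" for v
    by (rule linearI) (simp_all add: add_left scale_left)
  then have "linear (\<lambda>v. local_metric A g c x v u)" .
  moreover have "(\<lambda>v. local_metric A g c x v u) = local_metric A g c x u"
    using sym[of _ u] by auto
  ultimately show "linear (local_metric A g c x u)" by simp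
qed

section \<open>Christoffel symbols\<close>

lemma local_metric_differentiable:
  "c \<in> A \<Longrightarrow> x \<in> snd c ` fst c \<Longrightarrow> (\<lambda>y. local_metric A g c y u v) differentiable (at x)"
  using smooth_on_differentiable metric_smooth by blast

text \<open>Additivity survives differentiation because it holds at all points of the open chart
  image.\<close>

lemma fderiv_local_metric_add:
  assumes c: "c \<in> A" and x: "x \<in> snd c ` fst c"
  shows "fderiv (\<lambda>y. local_metric A g c y u (v + w)) x t =
    fderiv (\<lambda>y. local_metric A g c y u v) x t + fderiv (\<lambda>y. local_metric A g c y u w) x t"
proof -
  have "((\<lambda>y. local_metric A g c y u v + local_metric A g c y u w) has_derivative
      (\<lambda>t. fderiv (\<lambda>y. local_metric A g c y u v) x t + fderiv (\<lambda>y. local_metric A g c y u w) x t)) (at x)"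
    using local_metric_differentiable[OF c x]
    by (intro has_derivative_add) (simp_all add: frechet_derivative_works[symmetric])
  then have "((\<lambda>y. local_metric A g c y u (v + w)) has_derivative
      (\<lambda>t. fderiv (\<lambda>y. local_metric A g c y u v) x t + fderiv (\<lambda>y. local_metric A g c y u w) x t)) (at x)"
    by (rule has_derivative_transform_within_open[OF _ open_chart_image[OF c] x])
       (simp add: linear_add[OF linear_local_metric(1)[OF c]])
  then show ?thesis by (rule fun_cong[OF fderiv_eqI])
qed

lemma fderiv_local_metric_scale:
  assumes c: "c \<in> A" and x: "x \<in> snd c ` fst c"
  shows "fderiv (\<lambda>y. local_metric A g c y u (r *\<^sub>R v)) x t =
    r * fderiv (\<lambda>y. local_metric A g c y u v) x t"
proof -
  have "((\<lambda>y. r * local_metric A g c y u v) has_derivative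
      (\<lambda>t. r * fderiv (\<lambda>y. local_metric A g c y u v) x t)) (at x)"
    using local_metric_differentiable[OF c x]
    by (intro has_derivative_mult_right) (simp add: frechet_derivative_works[symmetric])
  then have "((\<lambda>y. local_metric A g c y u (r *\<^sub>R v)) has_derivative
      (\<lambda>t. r * fderiv (\<lambda>y. local_metric A g c y u v) x t)) (at x)"
    by (rule has_derivative_transform_within_open[OF _ open_chart_image[OF c] x])
       (simp add: linear_scale[OF linear_local_metric(1)[OF c]])
  then show ?thesis by (rule fun_cong[OF fderiv_eqI])
qed

text \<open>The definite description is justified: the right-hand side is linear in
  \<open>z\<close>, so \<open>Riesz\<close> gives a solution, and positive definiteness makes it
  unique.\<close>

lemma christoffel_eq:
  assumes c: "c \<in> A" and x: "x \<in> snd c ` fst c"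
  defines "G \<equiv> local_metric A g c"
  shows "2 * G x (christoffel G x u v) z =
      fderiv (\<lambda>y. G y v z) x u + fderiv (\<lambda>y. G y u z) x v - fderiv (\<lambda>y. G y u v) x z"
proof -
  interpret inner_product_on UNIV "G x"
    unfolding G_def by (rule inner_product_on_local_metric[OF c x])
  define R where "R = (\<lambda>z. fderiv (\<lambda>y. G y v z) x u + fderiv (\<lambda>y. G y u z) x v - fderiv (\<lambda>y. G y u v) x z)"
  have lin: "linear (fderiv (\<lambda>y. G y u v) x)"
    unfolding G_def by (rule linear_fderiv[OF local_metric_differentiable[OF c x]])
  have add: "R (z + z') = R z + R z'" for z z'
    unfolding R_def linear_add[OF lin] unfolding G_def fderiv_local_metric_add[OF c x] by simp
  have scale: "R (r *\<^sub>R z) = r * R z" for r z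
    unfolding R_def linear_scale[OF lin]
    unfolding G_def fderiv_local_metric_scale[OF c x] by (simp add: algebra_simps)
  obtain w where w: "\<And>z. G x w z = R z / 2"
    using Riesz[of "\<lambda>z. R z / 2"] by (auto simp: add scale add_divide_distrib)
  have "\<exists>!w. \<forall>z. 2 * G x w z = R z"
  proof (rule ex1I)
    show "\<forall>z. 2 * G x w z = R z" by (subst w) simp
    fix w' assume "\<forall>z. 2 * G x w' z = R z"
    then have "G x w' z = G x w z" for z using w[of z] by (metis nonzero_mult_div_cancel_left zero_neq_numeral)
    then show "w' = w" by (intro eqI) auto
  qed
  then have "\<forall>z. 2 * G x (christoffel G x u v) z = R z"
    unfolding christoffel_def R_def by (rule theI')
  then show ?thesis unfolding R_def by blast
qed

text \<open>The derivative of the constant inner product of \<open>X\<close> and \<open>Z\<close>,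
  written out in coordinates: one term for the metric and one for each field.\<close>

lemma fderiv_metric_fields:
  assumes X: "smooth_field A X" and Z: "smooth_field A Z"
    and const: "\<And>q. g q (X q) (Z q) = a" and c: "c \<in> charts_at A p"
  defines "G \<equiv> local_metric A g c" and "x \<equiv> snd c p"
  shows "fderiv (\<lambda>y. G y (X p c) (Z p c)) x v + G x (X p c) (fderiv (field_rep c Z) x v)
    + G x (fderiv (field_rep c X) x v) (Z p c) = 0"
proof -
  have c': "c \<in> A" "p \<in> fst c" using c by (auto simp: charts_at_iff)
  have S: "open (snd c ` fst c)" "x \<in> snd c ` fst c"
    using open_chart_image c' by (auto simp: x_def)
  let ?X = "field_rep c X" and ?Z = "field_rep c Z"
  have val: "?X x = X p c" "?Z x = Z p c" unfolding x_def by (rule field_rep_snd[OF c])+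
  have dX: "(?X has_derivative fderiv ?X x) (at x)" and dZ: "(?Z has_derivative fderiv ?Z x) (at x)"
    unfolding x_def by (rule field_rep_has_derivative[OF _ c], fact)+
  \<comment> \<open>The three-term rule takes two applications of
    \<open>has_derivative_linear_family\<close>: first the second slot varies with \<open>b\<close>
    frozen, then the first slot varies in the resulting family.\<close>
  have 1: "((\<lambda>y. G y b (?Z y)) has_derivative
      (\<lambda>v. fderiv (\<lambda>y. G y b (?Z x)) x v + G x b (fderiv ?Z x v))) (at x)" for b
    unfolding G_def
    by (rule has_derivative_linear_family[OF finite_dim S linear_local_metric(1)[OF c'(1)]
          local_metric_differentiable[OF c'(1) S(2)] dZ])
  have 2: "((\<lambda>y. G y (?X y) (?Z y)) has_derivative
      (\<lambda>v. fderiv (\<lambda>y. G y (?X x) (?Z y)) x v + G x (fderiv ?X x v) (?Z x))) (at x)"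
  proof (rule has_derivative_linear_family[OF finite_dim S _ _ dX, of "\<lambda>y b. G y b (?Z y)"])
    show "linear (\<lambda>b. G y b (?Z y))" if "y \<in> snd c ` fst c" for y
      unfolding G_def by (rule linear_local_metric(2)[OF c'(1) that])
    show "(\<lambda>y. G y b (?Z y)) differentiable (at x)" for b
      using 1 unfolding differentiable_def by blast
  qed
  have 3: "fderiv (\<lambda>y. G y (?X x) (?Z y)) x v =
      fderiv (\<lambda>y. G y (?X x) (?Z x)) x v + G x (?X x) (fderiv ?Z x v)" for v
    by (rule fun_cong[OF fderiv_eqI[OF 1]])
  have "((\<lambda>y. a) has_derivative
      (\<lambda>v. fderiv (\<lambda>y. G y (?X x) (?Z y)) x v + G x (fderiv ?X x v) (?Z x))) (at x)"
  proof (rule has_derivative_transform_within_open[OF 2 S])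
    fix y assume "y \<in> snd c ` fst c"
    then obtain q where q: "y = snd c q" "c \<in> charts_at A q" using c'(1) by (auto simp: charts_at_iff)
    have "X q \<in> tangent_space A q" "Z q \<in> tangent_space A q"
      using X Z unfolding smooth_field_def by auto
    from local_metric_component[OF q(2) this] show "G y (?X y) (?Z y) = a"
      using const by (simp add: q(1) field_rep_snd[OF q(2)] G_def)
  qed
  then have "(\<lambda>v. fderiv (\<lambda>y. G y (?X x) (?Z y)) x v + G x (fderiv ?X x v) (?Z x)) = (\<lambda>v. 0)"
    using has_derivative_const has_derivative_unique by blast
  from fun_cong[OF this, of v] show ?thesis using 3[of v] by (simp add: val)
qed

text \<open>In direction \<open>X\<close> the Christoffel term contains
  \<open>fderiv (\<lambda>y. G y ?u ?z) x ?u\<close> twice and subtracts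
  \<open>fderiv (\<lambda>y. G y ?u ?u) x ?z\<close>. Constancy of the two inner products replaces
  these by derivatives of \<open>X\<close> and \<open>Z\<close>, and what is left is the coordinate
  bracket.\<close>

lemma Koszul:
  assumes X: "smooth_field A X" and Z: "smooth_field A Z"
    and XZ: "\<And>q. g q (X q) (Z q) = a" and XX: "\<And>q. g q (X q) (X q) = b"
    and c: "c \<in> charts_at A p"
  defines "G \<equiv> local_metric A g c" and "x \<equiv> snd c p"
  shows "G x (fderiv (field_rep c X) x (X p c) + christoffel G x (X p c) (X p c)) (Z p c)
    = g p (field_bracket A Z X p) (X p)"
proof -
  have c': "c \<in> A" "p \<in> fst c" using c by (auto simp: charts_at_iff)
  have S: "x \<in> snd c ` fst c" using c' by (auto simp: x_def)
  interpret I: inner_product_on UNIV "G x"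
    unfolding G_def by (rule inner_product_on_local_metric[OF c'(1) S])
  let ?u = "X p c" and ?z = "Z p c" and ?DX = "fderiv (field_rep c X) x" and ?DZ = "fderiv (field_rep c Z) x"
  have 1: "fderiv (\<lambda>y. G y ?u ?z) x ?u + G x ?u (?DZ ?u) + G x (?DX ?u) ?z = 0"
    unfolding G_def x_def by (rule fderiv_metric_fields[OF X Z XZ c])
  have 2: "fderiv (\<lambda>y. G y ?u ?u) x ?z + G x ?u (?DX ?z) + G x (?DX ?z) ?u = 0"
    unfolding G_def x_def by (rule fderiv_metric_fields[OF X X XX c])
  have 3: "2 * G x (christoffel G x ?u ?u) ?z =
      fderiv (\<lambda>y. G y ?u ?z) x ?u + fderiv (\<lambda>y. G y ?u ?z) x ?u - fderiv (\<lambda>y. G y ?u ?u) x ?z"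
    unfolding G_def by (rule christoffel_eq[OF c'(1) S])
  have "X p \<in> tangent_space A p" using X unfolding smooth_field_def by auto
  from local_metric_component[OF c field_bracket_in[OF Z X] this]
  have "g p (field_bracket A Z X p) (X p) = G x (?DX ?z - ?DZ ?u) ?u"
    using c by (simp add: field_bracket_def G_def x_def)
  then show ?thesis
    using 1 2 3 I.sym[of ?u "?DX ?z"] I.sym[of ?u "?DZ ?u"] by (simp add: I.add_left I.diff_left)
qed

end

section \<open>The tension field of a homomorphism\<close>

lemma sum_fun_apply: "(\<Sum>i\<in>I. f i) x = (\<Sum>i\<in>I. f i x)"
  by (induction I rule: infinite_finite_induct) auto

text \<open>The component of \<open>\<nabla>\<^sub>X X\<close> at \<open>p\<close> in the chart \<open>c\<close>.\<close>

definition self_deriv ::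
  "('m, 'e::real_normed_vector) chart set \<Rightarrow>
   ('m \<Rightarrow> ('m, 'e) tangent \<Rightarrow> ('m, 'e) tangent \<Rightarrow> real) \<Rightarrow> ('m, 'e) chart \<Rightarrow>
   ('m \<Rightarrow> ('m, 'e) tangent) \<Rightarrow> 'm \<Rightarrow> 'e"
  where "self_deriv A g c X p = fderiv (field_rep c X) (snd c p) (X p c)
    + christoffel (local_metric A g c) (snd c p) (X p c) (X p c)"

context riemannian_lie_group
begin

lemma left_field_metric:
  assumes "u \<in> \<LL>" "v \<in> \<LL>"
  shows "g a (LF u a) (LF v a) = g one u v"
  using left_invariant[of u one v a] assms by (simp add: left_invariant_field_def lie_algebra_def)

lemma inner_product_on_lie_algebra: "inner_product_on \<LL> (g one)"
  unfolding lie_algebra_def by (rule inner_product_on_tangent)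

text \<open>The basis in \<open>tension_field\<close> is an arbitrary one at \<open>p\<close>.
  Evaluation of left invariant fields at \<open>p\<close> is a linear isometry from the Lie algebra,
  so the preimage of the basis is orthonormal there and its elements extend to fields.\<close>

lemma left_translated_orthonormal_basis:
  assumes E: "orthonormal_basis A g p E"
  obtains E' where "inner_product_on.orthonormal \<LL> (g one) E'" "bij_betw (\<lambda>w. LF w p) E' E"
proof
  define E' where "E' = {w \<in> \<LL>. LF w p \<in> E}"
  have ET: "E \<subseteq> tangent_space A p" and fin: "finite E" and span: "span E = tangent_space A p"
    and on: "\<And>u v. u \<in> E \<Longrightarrow> v \<in> E \<Longrightarrow> g p u v = (if u = v then 1 else 0)"
    using E unfolding orthonormal_basis_def by auto
  have inj: "inj_on (\<lambda>w. LF w p) \<LL>" using left_field_inj by (intro inj_onI)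
  have im: "(\<lambda>w. LF w p) ` E' = E"
  proof
    show "E \<subseteq> (\<lambda>w. LF w p) ` E'"
    proof
      fix v assume v: "v \<in> E"
      obtain w where "w \<in> \<LL>" "LF w p = v" using left_field_surj[of v p] v ET by auto
      then show "v \<in> (\<lambda>w. LF w p) ` E'" using v by (auto simp: E'_def)
    qed
  qed (auto simp: E'_def)
  show bij: "bij_betw (\<lambda>w. LF w p) E' E"
    using im inj_on_subset[OF inj] by (simp add: bij_betw_def E'_def)
  have sub: "subspace \<LL>" unfolding lie_algebra_def by (rule subspace_tangent_space)
  have E'L: "E' \<subseteq> \<LL>" by (auto simp: E'_def)
  have "span E' = \<LL>"
  proof
    show le: "span E' \<subseteq> \<LL>" using span_minimal[OF E'L sub] .
    show "\<LL> \<subseteq> span E'"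
    proof
      fix w assume w: "w \<in> \<LL>"
      have "LF w p \<in> span ((\<lambda>w. LF w p) ` E')" using left_field_in[OF w] by (simp add: im span)
      then obtain w' where "w' \<in> span E'" "LF w p = LF w' p"
        using span_linear_image[OF linear_left_field] by auto
      then show "w \<in> span E'" using left_field_inj[OF w] le by auto
    qed
  qed
  moreover have "finite E'" using bij fin bij_betw_finite by blast
  moreover have "g one u v = (if u = v then 1 else 0)" if "u \<in> E'" "v \<in> E'" for u v
  proof -
    have "g one u v = g p (LF u p) (LF v p)" using that E'L left_field_metric[of u v p] by (metis subsetD)
    also have "\<dots> = (if u = v then 1 else 0)"
      using that E'L on left_field_inj[of u v p] by (auto simp: E'_def)
    finally show ?thesis .
  qed
  ultimately show "inner_product_on.orthonormal \<LL> (g one) E'"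
    using E'L unfolding inner_product_on.orthonormal_def[OF inner_product_on_lie_algebra] by blast
qed

text \<open>Left invariance makes all inner products constant, so \<open>Koszul\<close> applies; the
  bracket is left invariant too, so the result does not depend on \<open>p\<close>.\<close>

lemma self_deriv_left_field:
  assumes w: "w \<in> \<LL>" and z: "z \<in> \<LL>" and c: "c \<in> charts_at A p"
  shows "local_metric A g c (snd c p) (self_deriv A g c (LF w) p) (LF z p c) = g one (br z w) w"
proof -
  have "local_metric A g c (snd c p) (self_deriv A g c (LF w) p) (LF z p c)
      = g p (field_bracket A (LF z) (LF w) p) (LF w p)"
    unfolding self_deriv_def
    using left_field_metric w z by (intro Koszul smooth_left_field c) auto
  then show ?thesis using w z by (simp add: left_field_bracket left_field_metric bracket_in)
qed

text \<open>Stated for an arbitrary family \<open>W\<close>: on the source it is an orthonormal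
  basis, on the target the image of one, which need not span.\<close>

lemma sum_self_deriv_eq_0:
  assumes W: "\<And>i. i \<in> I \<Longrightarrow> W i \<in> \<LL>" and c: "c \<in> charts_at A p"
    and zero: "\<And>z. z \<in> \<LL> \<Longrightarrow> (\<Sum>i\<in>I. g one (br z (W i)) (W i)) = 0"
  shows "(\<Sum>i\<in>I. self_deriv A g c (LF (W i)) p) = 0"
proof -
  have c': "c \<in> A" "snd c p \<in> snd c ` fst c" using c by (auto simp: charts_at_iff)
  interpret I: inner_product_on UNIV "local_metric A g c (snd c p)"
    by (rule inner_product_on_local_metric[OF c'])
  show ?thesis
  proof (rule I.eqI)
    fix t
    obtain z where z: "z \<in> \<LL>" "LF z p = coord_vector A c p t"
      using left_field_surj[OF coord_vector_in[OF c]] by metis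
    then have t: "t = LF z p c" by (simp add: coord_vector_same[OF c])
    have "local_metric A g c (snd c p) (\<Sum>i\<in>I. self_deriv A g c (LF (W i)) p) t
        = (\<Sum>i\<in>I. local_metric A g c (snd c p) (self_deriv A g c (LF (W i)) p) t)"
      using I.sum_left[of I "\<lambda>i. self_deriv A g c (LF (W i)) p" t "\<lambda>_. 1"] by simp
    also have "\<dots> = (\<Sum>i\<in>I. g one (br z (W i)) (W i))"
      unfolding t using W z c by (intro sum.cong self_deriv_left_field) auto
    finally show "local_metric A g c (snd c p) (\<Sum>i\<in>I. self_deriv A g c (LF (W i)) p) t
        = local_metric A g c (snd c p) 0 t"
      using zero[OF z(1)] by (simp add: I.zero_left)
  qed auto
qed

end

text \<open>Differentiating \<open>df(X) = Y \<circ> f\<close> along \<open>X\<close> trades the second derivative of \<open>f\<close> for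
  derivatives of \<open>X\<close> and \<open>Y\<close>.\<close>

lemma second_fundamental_form_related:
  assumes A: "smooth_manifold A" and B: "smooth_manifold B" and f: "smooth_map A B f"
    and X: "smooth_field A X" and Y: "smooth_field B Y" and rel: "field_related A B f X Y"
    and d: "d \<in> charts_at B (f p)"
  defines "c \<equiv> chart_at A p"
  shows "second_fundamental_form A g B h f p (X p) (X p) d =
    self_deriv B h d Y (f p) - fderiv (coord_map c d f) (snd c p) (self_deriv A g c X p)"
proof -
  define F where "F = coord_map c d f"
  define x where "x = snd c p"
  have c: "c \<in> charts_at A p" unfolding c_def by (rule smooth_manifold.chart_at[OF A])
  have Xp: "X p \<in> tangent_space A p" using X unfolding smooth_field_def by auto
  have Fx: "F x = snd d (f p)"
    using smooth_manifold.chart_inv_snd[OF A] c by (simp add: F_def x_def coord_map_def charts_at_iff)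
  have DF: "fderiv F x (X p c) = Y (f p) d"
    using differential_component[OF A B f Xp c d] rel by (simp add: F_def x_def field_related_def)
  have lin: "linear (fderiv F x)"
    unfolding F_def x_def by (rule linear_fderiv[OF coord_map_differentiable[OF f c d]])
  have "second_fundamental_form A g B h f p (X p) (X p) d =
      fderiv (\<lambda>y. fderiv F y (X p c)) x (X p c)
      + christoffel (local_metric B h d) (snd d (f p)) (Y (f p) d) (Y (f p) d)
      - fderiv F x (christoffel (local_metric A g c) x (X p c) (X p c))"
    using d by (simp add: second_fundamental_form_def Let_def cov_deriv_along_def c_def[symmetric]
        F_def[symmetric] x_def[symmetric] DF Fx)
  moreover have "fderiv (\<lambda>y. fderiv F y (X p c)) x (X p c) =
      fderiv (field_rep d Y) (snd d (f p)) (Y (f p) d) - fderiv F x (fderiv (field_rep c X) x (X p c))"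
    using related_fderiv[OF A B f X Y rel c d, of "X p c"] DF
    by (simp add: F_def[symmetric] x_def[symmetric] algebra_simps)
  ultimately show ?thesis
    by (simp add: self_deriv_def F_def[symmetric] x_def[symmetric] linear_add[OF lin])
qed

section \<open>Homomorphisms and the theorem\<close>

lemma lie_group_hom_one:
  assumes "group mG eG iG" "group mH eH iH" and \<phi>: "lie_group_hom mG A mH B \<phi>"
  shows "\<phi> eG = eH"
proof -
  interpret G: group mG eG iG by fact
  interpret H: group mH eH iH by fact
  have "mH (\<phi> eG) (\<phi> eG) = mH (\<phi> eG) eH"
    using \<phi> unfolding lie_group_hom_def by (metis G.right_neutral H.right_neutral)
  then show ?thesis by (simp only: H.left_cancel)
qed

text \<open>A homomorphism intertwines translation by \<open>a\<close> with translation by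
  \<open>\<phi> a\<close>; the chain rule at the identity turns this into relatedness of the
  fields.\<close>

lemma left_field_hom_related:
  assumes G: "lie_group mG eG iG A" and H: "lie_group mH eH iH B" and \<phi>: "lie_group_hom mG A mH B \<phi>"
    and u: "u \<in> lie_algebra eG A"
  shows "differential A B \<phi> eG u \<in> lie_algebra eH B"
    and "field_related A B \<phi> (left_invariant_field mG eG A u)
      (left_invariant_field mH eH B (differential A B \<phi> eG u))"
proof -
  interpret G: lie_group mG eG iG A by fact
  interpret H: lie_group mH eH iH B by fact
  have sm: "smooth_map A B \<phi>" and hom: "\<And>a b. \<phi> (mG a b) = mH (\<phi> a) (\<phi> b)"
    using \<phi> unfolding lie_group_hom_def by auto
  have one: "\<phi> eG = eH"
    by (rule lie_group_hom_one[OF G.group_axioms H.group_axioms \<phi>])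
  have u': "u \<in> tangent_space A eG" using u by (simp add: lie_algebra_def)
  show "differential A B \<phi> eG u \<in> lie_algebra eH B"
    using differential_in[OF G.smooth_manifold H.smooth_manifold sm u'] by (simp add: lie_algebra_def one)
  show "field_related A B \<phi> (left_invariant_field mG eG A u)
      (left_invariant_field mH eH B (differential A B \<phi> eG u))"
    unfolding field_related_def
  proof
    fix a
    have "(\<lambda>q. \<phi> (mG a q)) = (\<lambda>q. mH (\<phi> a) (\<phi> q))" by (simp add: hom)
    then have "differential A B (\<lambda>q. \<phi> (mG a q)) eG u = differential A B (\<lambda>q. mH (\<phi> a) (\<phi> q)) eG u"
      by simp
    then show "differential A B \<phi> a (left_invariant_field mG eG A u a) =
        left_invariant_field mH eH B (differential A B \<phi> eG u) (\<phi> a)"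
      using differential_chain[OF G.smooth_manifold G.smooth_manifold H.smooth_manifold
          G.smooth_left_mul sm u', of a]
        differential_chain[OF G.smooth_manifold H.smooth_manifold H.smooth_manifold
          sm H.smooth_left_mul u', of "\<phi> a"]
      by (simp add: left_invariant_field_def one)
  qed
qed

theorem proposition2p11:
  fixes mG :: "'g::{t2_space, second_countable_topology} \<Rightarrow> 'g \<Rightarrow> 'g"
    and eG :: 'g and iG :: "'g \<Rightarrow> 'g"
    and A :: "('g, 'e::real_inner) chart set"
    and g :: "'g \<Rightarrow> ('g, 'e) tangent \<Rightarrow> ('g, 'e) tangent \<Rightarrow> real"
    and mH :: "'k::{t2_space, second_countable_topology} \<Rightarrow> 'k \<Rightarrow> 'k"
    and eH :: 'k and iH :: "'k \<Rightarrow> 'k"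
    and B :: "('k, 'f::real_inner) chart set"
    and h :: "'k \<Rightarrow> ('k, 'f) tangent \<Rightarrow> ('k, 'f) tangent \<Rightarrow> real"
    and \<phi> :: "'g \<Rightarrow> 'k"
  assumes "riemannian_lie_group mG eG iG A g"
    and "riemannian_lie_group mH eH iH B h"
    and "lie_group_hom mG A mH B \<phi>"
    and "riemannian_immersion A g B h \<phi>"
    and "derived_algebra (lie_algebra eG A) (lie_bracket mG eG A) = lie_algebra eG A"
    and "\<And>D. lie_derivation (lie_algebra eG A) (lie_bracket mG eG A) D \<Longrightarrow>
           inner_derivation (lie_algebra eG A) (lie_bracket mG eG A) D"
    and "lie_ideal (lie_algebra eH B) (lie_bracket mH eH B)
           (differential A B \<phi> eG ` lie_algebra eG A)"
  shows "harmonic A g B h \<phi>"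
proof -
  interpret G: riemannian_lie_group mG eG iG A g by fact
  interpret H: riemannian_lie_group mH eH iH B h by fact
  define \<xi> where "\<xi> = differential A B \<phi> eG"
  have sm: "smooth_map A B \<phi>" using assms(4) unfolding riemannian_immersion_def by blast
  have \<xi>_in: "\<xi> u \<in> H.\<LL>" and \<xi>_rel: "field_related A B \<phi> (G.LF u) (H.LF (\<xi> u))" if "u \<in> G.\<LL>" for u
    unfolding \<xi>_def using left_field_hom_related[OF G.lie_group_axioms H.lie_group_axioms assms(3) that] .
  have one: "\<phi> eG = eH"
    by (rule lie_group_hom_one[OF G.group_axioms H.group_axioms assms(3)])
  have lin: "linear \<xi>" unfolding \<xi>_def by (rule linear_differential[OF G.smooth_manifold sm])
  have \<xi>_bracket: "\<xi> (G.br u v) = H.br (\<xi> u) (\<xi> v)" if uv: "u \<in> G.\<LL>" "v \<in> G.\<LL>" for u v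
    using related_bracket[OF G.smooth_manifold H.smooth_manifold sm
        G.smooth_left_field[OF uv(1)] H.smooth_left_field[OF \<xi>_in[OF uv(1)]] \<xi>_rel[OF uv(1)]
        G.smooth_left_field[OF uv(2)] H.smooth_left_field[OF \<xi>_in[OF uv(2)]] \<xi>_rel[OF uv(2)]]
    unfolding field_related_def \<xi>_def lie_bracket_def by (metis one)
  have trace_G: "(\<Sum>e\<in>E. g eG (G.br z e) e) = 0"
    if "inner_product_on.orthonormal G.\<LL> (g eG) E" "z \<in> G.\<LL>" for E z
    using lie_algebra_on.trace_ad_eq_0[OF G.lie_algebra G.inner_product_on_lie_algebra that(1) assms(5) that(2)] .
  \<comment> \<open>\<open>z\<close> runs through the whole target algebra, so the sum of covariant
    derivatives on the target vanishes entirely, not just in its component normal to the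
    image.\<close>
  have trace_H: "(\<Sum>e\<in>E. h eH (H.br z (\<xi> e)) (\<xi> e)) = 0"
    if E: "inner_product_on.orthonormal G.\<LL> (g eG) E" and z: "z \<in> H.\<LL>" for E z
  proof (rule trace_ad_ideal_eq_0[OF G.lie_algebra H.lie_algebra G.inner_product_on_lie_algebra E
        \<xi>_in _ _ _ \<xi>_bracket _ assms(5,6) _ z])
    show "inj_on \<xi> G.\<LL>"
      using assms(4) unfolding riemannian_immersion_def \<xi>_def lie_algebra_def by blast
    show "h eH (\<xi> x) (\<xi> y) = g eG x y" if "x \<in> G.\<LL>" "y \<in> G.\<LL>" for x y
      using assms(4) that one unfolding riemannian_immersion_def \<xi>_def lie_algebra_def by metis
    show "lie_ideal H.\<LL> H.br (\<xi> ` G.\<LL>)" using assms(7) unfolding \<xi>_def .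
    show "\<xi> (x + y) = \<xi> x + \<xi> y" for x y by (rule linear_add[OF lin])
    show "\<xi> (r *\<^sub>R x) = r *\<^sub>R \<xi> x" for r x by (rule linear_scale[OF lin])
  qed
  have "tension_field A g B h \<phi> p = 0" for p
  proof -
    define E where "E = (SOME E. orthonormal_basis A g p E)"
    have E: "orthonormal_basis A g p E"
      unfolding E_def
    proof (rule someI_ex)
      show "\<exists>E. orthonormal_basis A g p E"
        using inner_product_on.orthonormal_exists[OF G.inner_product_on_tangent]
        by (simp add: G.orthonormal_basis_iff)
    qed
    obtain E' where E': "inner_product_on.orthonormal G.\<LL> (g eG) E'"
      and bij: "bij_betw (\<lambda>w. G.LF w p) E' E"
      using G.left_translated_orthonormal_basis[OF E] .
    have E'L: "w \<in> G.\<LL>" if "w \<in> E'" for w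
      using E' that unfolding inner_product_on.orthonormal_def[OF G.inner_product_on_lie_algebra] by blast
    show "tension_field A g B h \<phi> p = 0"
    proof
      fix d
      \<comment> \<open>Each basis vector at \<open>p\<close> becomes the value of a left invariant
        field, because \<open>second_fundamental_form_related\<close> works with fields rather than
        single vectors.\<close>
      have tension: "tension_field A g B h \<phi> p d =
          (\<Sum>w\<in>E'. second_fundamental_form A g B h \<phi> p (G.LF w p) (G.LF w p) d)"
        unfolding tension_field_def E_def[symmetric] sum_fun_apply
        by (rule sum.reindex_bij_betw[OF bij, symmetric])
      show "tension_field A g B h \<phi> p d = 0 d"
      proof (cases "d \<in> charts_at B (\<phi> p)")
        case d: True
        define c where "c = chart_at A p"
        have c: "c \<in> charts_at A p" unfolding c_def by (rule G.chart_at)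
        let ?D = "fderiv (coord_map c d \<phi>) (snd c p)"
        have linD: "linear ?D" by (rule linear_fderiv[OF coord_map_differentiable[OF sm c d]])
        have "tension_field A g B h \<phi> p d =
            (\<Sum>w\<in>E'. self_deriv B h d (H.LF (\<xi> w)) (\<phi> p) - ?D (self_deriv A g c (G.LF w) p))"
          unfolding tension c_def
          using E'L \<xi>_in \<xi>_rel d
          by (intro sum.cong second_fundamental_form_related G.smooth_manifold H.smooth_manifold sm
              G.smooth_left_field H.smooth_left_field) auto
        also have "\<dots> = (\<Sum>w\<in>E'. self_deriv B h d (H.LF (\<xi> w)) (\<phi> p))
            - ?D (\<Sum>w\<in>E'. self_deriv A g c (G.LF w) p)"
          by (simp add: sum_subtractf linear_sum[OF linD])
        also have "(\<Sum>w\<in>E'. self_deriv B h d (H.LF (\<xi> w)) (\<phi> p)) = 0"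
          using E'L \<xi>_in trace_H[OF E'] by (intro H.sum_self_deriv_eq_0[OF _ d]) auto
        also have "(\<Sum>w\<in>E'. self_deriv A g c (G.LF w) p) = 0"
          using E'L trace_G[OF E'] by (intro G.sum_self_deriv_eq_0[OF _ c]) auto
        finally show ?thesis by (simp add: linear_0[OF linD])
      next
        \<comment> \<open>Components at charts not around \<open>\<phi> p\<close> are 0 by the
          convention for tangent vectors.\<close>
        case False
        then show ?thesis unfolding tension by (simp add: second_fundamental_form_def)
      qed
    qed
  qed
  then show ?thesis using sm unfolding harmonic_def by blast
qed

end
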